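(* Let $f\colon [0,\infty)\to (0,\infty)$ be a non-decreasing function such that $\sum_{n=1}^{\infty} \frac{1}{f(2^n)}<\infty$. Let $0<r<2$ and let $p\geq r$. Let $\{X_n\}_{n\geq 1}$ be a (i) sequence of arbitrary random variables if $0<r\leq p\leq 1$ and $r<1$, (ii) martingale difference sequence if $1<p\leq 2$ or $r=p=1$, (iii) centered, negatively associated sequence of random variables if $p\geq 2$. (That is, the conclusion below holds in each of the three cases.) If $\sup_{n\geq 1} \mathbb{E}(|X_n|^p f(|X_n|))<\infty$, then for all $\varepsilon>0$ we have $$\sum_{n=1}^{\infty} n^{p/r-2}\, \mathbb{P}(M_n>\varepsilon n^{1/r})<\infty.$$
   Context: All random variables are real-valued and those in a sequence $\{X_n\}_{n\geq 1}$ are defined on the same probability space $(\Omega,\mathcal{F},\mathbb{P})$. For $n\geq 1$ let $S_n=\sum_{i=1}^n X_i$ and $M_n=\max_{1\leq i\leq n}|S_i|$. A random variable $X$ is centered if $\mathbb{E}(X)=0$; a sequence is centered if all its members are. $\{X_n\}_{n\geq 1}$ is a martingale difference sequence if there is a filtration $\{\mathcal{F}_n\}_{n\geq 0}$ such that $\mathcal{F}_0=\{\emptyset,\Omega\}$, $X_n$ is (integrable and) $\mathcal{F}_n$-measurable, and $\mathbb{E}(X_n\,|\,\mathcal{F}_{n-1})=0$ for all $n\geq 1$. A finite family $\{X_i: 1\leq i\leq n\}$ is negatively associated if for every pair of disjoint subsets $A_1,A_2\subset\{1,\dots,n\}$ we have $\mathrm{Cov}(f_1(X_i: i\in A_1),\,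 f_2(X_j: j\in A_2))\leq 0$ for all coordinatewise non-decreasing functions $f_1,f_2$ for which the covariance exists. An infinite family is negatively associated if every finite subfamily is. *)

theory Defs
  imports "HOL-Probability.Probability"
begin

text \<open>Sequences are indexed from 1 on; the value at index 0 of a sequence
  \<open>X :: nat \<Rightarrow> 'a \<Rightarrow> real\<close> is irrelevant to all notions below.\<close>

definition partial_sum :: "(nat \<Rightarrow> 'a \<Rightarrow> real) \<Rightarrow> nat \<Rightarrow> 'a \<Rightarrow> real" where
  "partial_sum X n \<omega> = (\<Sum>i = 1..n. X i \<omega>)"

definition max_partial_sum :: "(nat \<Rightarrow> 'a \<Rightarrow> real) \<Rightarrow> nat \<Rightarrow> 'a \<Rightarrow> real" where
  "max_partial_sum X n \<omega> = (MAX i\<in>{1..n}. \<bar>partial_sum X i \<omega>\<bar>)"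

text \<open>Integrability is required explicitly because the Bochner integral of a
  non-integrable function is 0.\<close>

definition centered :: "'a measure \<Rightarrow> ('a \<Rightarrow> real) \<Rightarrow> bool" where
  "centered M X \<longleftrightarrow> integrable M X \<and> (\<integral>\<omega>. X \<omega> \<partial>M) = 0"

definition martingale_difference_seq :: "'a measure \<Rightarrow> (nat \<Rightarrow> 'a \<Rightarrow> real) \<Rightarrow> bool" where
  "martingale_difference_seq M X \<longleftrightarrow>
     (\<exists>F :: nat \<Rightarrow> 'a measure.
        filtration (space M) F \<and>
        (\<forall>n. subalgebra M (F n)) \<and>
        sets (F 0) = {{}, space M} \<and>
        (\<forall>n\<ge>1. integrable M (X n) \<and>
               X n \<in> borel_measurable (F n) \<and>
               (AE \<omega> in M. real_cond_exp M (F (n - 1)) (X n) \<omega> = 0)))"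

definition covariance_exists :: "'a measure \<Rightarrow> ('a \<Rightarrow> real) \<Rightarrow> ('a \<Rightarrow> real) \<Rightarrow> bool" where
  "covariance_exists M Y Z \<longleftrightarrow>
     integrable M Y \<and> integrable M Z \<and> integrable M (\<lambda>\<omega>. Y \<omega> * Z \<omega>)"

definition covariance :: "'a measure \<Rightarrow> ('a \<Rightarrow> real) \<Rightarrow> ('a \<Rightarrow> real) \<Rightarrow> real" where
  "covariance M Y Z =
     (\<integral>\<omega>. Y \<omega> * Z \<omega> \<partial>M) - (\<integral>\<omega>. Y \<omega> \<partial>M) * (\<integral>\<omega>. Z \<omega> \<partial>M)"

text \<open>A function of the family \<open>(x\<^sub>i)\<close>, \<open>i \<in> A\<close>, is a function on the extensional
  functions \<open>A \<rightarrow>\<^sub>E UNIV\<close>, where the order of functions is the coordinatewise order on \<open>A\<close>.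
  No Borel measurability of the monotone functions is imposed; measurability of the
  compositions is part of the existence of the covariance.\<close>

definition neg_associated_finite :: "'a measure \<Rightarrow> ('i \<Rightarrow> 'a \<Rightarrow> real) \<Rightarrow> 'i set \<Rightarrow> bool" where
  "neg_associated_finite M X I \<longleftrightarrow>
     (\<forall>A\<^sub>1 A\<^sub>2. A\<^sub>1 \<subseteq> I \<longrightarrow> A\<^sub>2 \<subseteq> I \<longrightarrow> A\<^sub>1 \<inter> A\<^sub>2 = {} \<longrightarrow>
       (\<forall>(f\<^sub>1 :: ('i \<Rightarrow> real) \<Rightarrow> real) (f\<^sub>2 :: ('i \<Rightarrow> real) \<Rightarrow> real).
          mono_on (A\<^sub>1 \<rightarrow>\<^sub>E UNIV) f\<^sub>1 \<longrightarrow> mono_on (A\<^sub>2 \<rightarrow>\<^sub>E UNIV) f\<^sub>2 \<longrightarrow>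
          (let Y = (\<lambda>\<omega>. f\<^sub>1 (\<lambda>i\<in>A\<^sub>1. X i \<omega>)); Z = (\<lambda>\<omega>. f\<^sub>2 (\<lambda>j\<in>A\<^sub>2. X j \<omega>))
           in covariance_exists M Y Z \<longrightarrow> covariance M Y Z \<le> 0)))"

definition neg_associated :: "'a measure \<Rightarrow> ('i \<Rightarrow> 'a \<Rightarrow> real) \<Rightarrow> 'i set \<Rightarrow> bool" where
  "neg_associated M X I \<longleftrightarrow> (\<forall>J. finite J \<longrightarrow> J \<subseteq> I \<longrightarrow> neg_associated_finite M X J)"

end

theory Submission
  imports Defs "HOL-Real_Asymp.Real_Asymp"
begin

text \<open>
  Put \<open>c = \<epsilon> n\<^bsup>1/r\<^esup>\<close>. The moment hypothesis gives
  \<open>\<tau>(b) = sup\<^sub>i E(|X\<^sub>i|\<^bsup>p\<^esup>; |X\<^sub>i| > b) \<le> K / f(b)\<close>. In each case \<open>P(M\<^sub>n > c)\<close> is at most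
  a constant times \<open>n c\<^bsup>-p\<^esup> \<tau>(b)\<close> with \<open>b\<close> a positive power of \<open>n\<close>, plus a term that decays fast enough
  to be summable with the weights. The weight \<open>n\<^bsup>p/r-2\<^esup>\<close> turns the first term into
  \<open>1 / (n f(b))\<close>, which is summable by Cauchy condensation.

  (i) For \<open>p \<le> 1\<close>, summands below \<open>b = c / (2n)\<close> contribute at most \<open>c / 2\<close>, and the rest is handled by
  subadditivity of \<open>x\<^bsup>p\<^esup>\<close>.

  (ii) Truncate the martingale differences at a small power \<open>b\<close> of \<open>n\<close> and recentre conditionally. The
  bounded part satisfies an Azuma-type exponential bound. The unbounded part \<open>Z\<close> obeys
  \<open>P(max > c) \<le> 4 c\<^bsup>-p\<^esup> \<Sum> E|Z\<^sub>k|\<^bsup>p\<^esup>\<close>: stop the walk when it leaves \<open>[-c, c]\<close> and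
  follow the expectation of \<open>min(T\<^sup>2, c\<^sup>2)\<close>, for which the linear term of the increment is orthogonal to the past.

  (iii) Clip at \<open>\<theta> n\<^bsup>1/r\<^esup>\<close> with \<open>\<theta>\<close> small. For negatively associated variables the exponential
  moment of the clipped sum is at most the product of the exponential moments, and since \<open>2/r > 1\<close> a
  Chernoff bound with \<open>t\<close> proportional to \<open>ln n / n\<^bsup>1/r\<^esup>\<close> gives any prescribed polynomial decay; the
  maximum then costs only a union bound.
\<close>

subsection \<open>Inequalities for real numbers\<close>

text \<open>The triangle inequality reduces this to convexity of the power on positive numbers; if
  an endpoint is 0, it comes down to s^p <= s for s in [0, 1]. It feeds the conditional Jensen
  inequality.\<close>

lemma convex_on_abs_powr:
  fixes p :: real
  assumes "p \<ge> 1"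
  shows "convex_on UNIV (\<lambda>x::real. \<bar>x\<bar> powr p)"
proof (rule convex_onI)
  fix t x y :: real assume t: "0 < t" "t < 1"
  have sub: "(s * z) powr p \<le> s * z powr p" if "0 \<le> s" "s \<le> 1" "0 \<le> z" for s z :: real
  proof -
    have "s powr p \<le> s"
      using powr_mono_both'[of 1 p s s] that assms by (cases "s = 0") auto
    then show ?thesis using that by (simp add: powr_mult mult_right_mono)
  qed
  have "\<bar>(1 - t) *\<^sub>R x + t *\<^sub>R y\<bar> powr p \<le> ((1 - t) * \<bar>x\<bar> + t * \<bar>y\<bar>) powr p"
  proof (rule powr_mono2)
    show "\<bar>(1 - t) *\<^sub>R x + t *\<^sub>R y\<bar> \<le> (1 - t) * \<bar>x\<bar> + t * \<bar>y\<bar>"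
      using abs_triangle_ineq[of "(1 - t) * x" "t * y"] t by (simp add: abs_mult)
  qed (use assms in auto)
  also have "\<dots> \<le> (1 - t) * \<bar>x\<bar> powr p + t * \<bar>y\<bar> powr p"
  proof (cases "x = 0 \<or> y = 0")
    case True
    then show ?thesis using sub[of t "\<bar>y\<bar>"] sub[of "1 - t" "\<bar>x\<bar>"] t assms by auto
  next
    case False
    then show ?thesis
      using convex_onD[OF powr_convex[OF assms], of t "\<bar>x\<bar>" "\<bar>y\<bar>"] t by simp
  qed
  finally show "\<bar>(1 - t) *\<^sub>R x + t *\<^sub>R y\<bar> powr p
      \<le> (1 - t) * \<bar>x\<bar> powr p + t * \<bar>y\<bar> powr p" .
qed auto

lemma abs_add_powr_le:
  fixes p x y :: real
  assumes "p \<ge> 0"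
  shows "\<bar>x + y\<bar> powr p \<le> 2 powr p * (\<bar>x\<bar> powr p + \<bar>y\<bar> powr p)"
proof -
  have "\<bar>x + y\<bar> powr p \<le> (2 * max \<bar>x\<bar> \<bar>y\<bar>) powr p"
    using assms by (intro powr_mono2) auto
  also have "\<dots> = 2 powr p * (max \<bar>x\<bar> \<bar>y\<bar>) powr p"
    by (simp add: powr_mult)
  also have "\<dots> \<le> 2 powr p * (\<bar>x\<bar> powr p + \<bar>y\<bar> powr p)"
    by (intro mult_left_mono) (auto simp: max_def)
  finally show ?thesis .
qed

text \<open>For |y| <= 4c expand the square: y^2 = |y|^(2-p) |y|^p, whose first factor is at most
  (4c)^(2-p). For larger y only the cap c^2 has to be beaten. The term 2xy is kept exact because it
  averages out for martingales.\<close>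

lemma min_square_le_powr:
  fixes x y c p :: real
  assumes "\<bar>x\<bar> \<le> c" "c > 0" "1 \<le> p" "p \<le> 2"
  shows "min ((x + y)\<^sup>2) (c\<^sup>2) \<le> x\<^sup>2 + 2 * x * y + (4 * c) powr (2 - p) * \<bar>y\<bar> powr p"
proof (cases "y = 0")
  case True
  then show ?thesis by simp
next
  case False
  have y2: "y\<^sup>2 = \<bar>y\<bar> powr (2 - p) * \<bar>y\<bar> powr p"
    using False by (simp add: powr_add[symmetric] powr_numeral)
  show ?thesis
  proof (cases "\<bar>y\<bar> \<le> 4 * c")
    case True
    have "y\<^sup>2 \<le> (4 * c) powr (2 - p) * \<bar>y\<bar> powr p"
      unfolding y2 using True assms by (intro mult_right_mono powr_mono2) auto
    then show ?thesis by (simp add: power2_sum min_def)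
  next
    case far: False
    \<comment> \<open>As |x| <= c, the term 2xy can be as low as -2c|y|. The power term is at least
      4c|y|, and the remaining 2c|y| exceeds c^2.\<close>
    have "4 * c * \<bar>y\<bar> = (4 * c) powr (2 - p) * ((4 * c) powr (p - 1) * \<bar>y\<bar>)"
      using assms by (simp add: powr_add[symmetric] mult.assoc[symmetric])
    also have "\<dots> \<le> (4 * c) powr (2 - p) * (\<bar>y\<bar> powr (p - 1) * \<bar>y\<bar>)"
      using assms far by (intro mult_left_mono mult_right_mono powr_mono2) auto
    also have "\<bar>y\<bar> powr (p - 1) * \<bar>y\<bar> = \<bar>y\<bar> powr p"
      using False by (simp add: powr_diff)
    finally have 1: "4 * c * \<bar>y\<bar> \<le> (4 * c) powr (2 - p) * \<bar>y\<bar> powr p" .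
    have "\<bar>x * y\<bar> \<le> c * \<bar>y\<bar>"
      using assms by (simp add: abs_mult mult_right_mono)
    then have "x * y \<ge> - (c * \<bar>y\<bar>)" by (simp add: abs_le_iff)
    moreover have "c * \<bar>y\<bar> \<ge> 4 * c\<^sup>2"
      using far assms mult_left_mono[of "4 * c" "\<bar>y\<bar>" c] by (simp add: power2_eq_square)
    moreover have "c\<^sup>2 \<ge> 0" "x\<^sup>2 \<ge> 0" by auto
    ultimately have "c\<^sup>2 \<le> x\<^sup>2 + 2 * (x * y) + 4 * (c * \<bar>y\<bar>)"
      by linarith
    then show ?thesis using 1 by (simp add: mult.assoc min.coboundedI2)
  qed
qed

section \<open>Quadratic bounds for the exponential and subadditivity of powers\<close>

lemma exp_le_quadratic:
  fixes x :: real
  assumes "x \<le> 1"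
  shows "exp x \<le> 1 + x + x\<^sup>2"
proof (cases "x \<ge> 0")
  case True
  then show ?thesis using exp_bound[of x] assms by auto
next
  case False
  define y where "y = - x"
  have y: "0 \<le> y" using False by (simp add: y_def)
  \<comment> \<open>Multiplying \<open>1 - y + y\<^sup>2\<close> by 1 + y gives 1 + y^3 >= 1, while
    1 + y <= exp y; nonnegativity of the quadratic lets the two be combined.\<close>
  have pos: "0 \<le> 1 - y + y\<^sup>2"
    using zero_le_power2[of "y - 1"] y unfolding power2_diff by simp
  have "1 \<le> 1 + y ^ 3" using y by simp
  also have "1 + y ^ 3 = (1 - y + y\<^sup>2) * (1 + y)"
    by (simp add: algebra_simps power2_eq_square power3_eq_cube)
  also have "\<dots> \<le> (1 - y + y\<^sup>2) * exp y"
    using pos by (intro mult_left_mono exp_ge_add_one_self)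
  finally show ?thesis
    by (simp add: y_def exp_minus field_simps)
qed

text \<open>For x >= 0, multiply (1 + x)(1 - x) <= (1 + x) exp(-x) by exp x. No upper limit is put
  on x, since the Chernoff argument below uses exponents that grow with ln n.\<close>

lemma exp_le_quadratic_exp:
  fixes x :: real
  shows "exp x \<le> 1 + x + x\<^sup>2 * exp \<bar>x\<bar>"
proof (cases "x \<ge> 0")
  case True
  have "1 - x\<^sup>2 = (1 + x) * (1 + - x)" by (simp add: algebra_simps power2_eq_square)
  also have "\<dots> \<le> (1 + x) * exp (- x)"
    using True by (intro mult_left_mono exp_ge_add_one_self) auto
  finally have "(1 - x\<^sup>2) * exp x \<le> (1 + x) * exp (- x) * exp x" by (rule mult_right_mono) simp
  then show ?thesis using True by (simp add: exp_minus algebra_simps)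
next
  case False
  have "x\<^sup>2 \<le> x\<^sup>2 * exp \<bar>x\<bar>"
    using mult_left_mono[of 1 "exp \<bar>x\<bar>" "x\<^sup>2"] by simp
  moreover have "exp x \<le> 1 + x + x\<^sup>2"
    using False by (intro exp_le_quadratic) simp
  ultimately show ?thesis by linarith
qed

text \<open>After division by the total s every ratio lies in [0, 1], where z <= z^p because p <= 1;
  the ratios sum to 1.\<close>

lemma sum_le_powr_sum:
  fixes x :: "'i \<Rightarrow> real"
  assumes "finite A" "0 < p" "p \<le> 1" "\<And>i. i \<in> A \<Longrightarrow> x i \<ge> 0"
  shows "(\<Sum>i\<in>A. x i) powr p \<le> (\<Sum>i\<in>A. x i powr p)"
proof (cases "(\<Sum>i\<in>A. x i) = 0")
  case False
  define s where "s = (\<Sum>i\<in>A. x i)"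
  have s: "s > 0" using False assms(4) by (simp add: s_def sum_nonneg less_le)
  have "s powr p = (\<Sum>i\<in>A. x i / s) * s powr p"
    using s by (simp add: s_def sum_divide_distrib[symmetric])
  also have "\<dots> = (\<Sum>i\<in>A. x i / s * s powr p)"
    by (simp add: sum_distrib_right)
  also have "\<dots> \<le> (\<Sum>i\<in>A. x i powr p)"
  proof (rule sum_mono)
    fix i assume i: "i \<in> A"
    have "x i \<le> s" unfolding s_def using i assms by (intro member_le_sum) auto
    then have "x i / s \<le> (x i / s) powr p"
      using powr_mono_both'[of p 1 "x i / s" "x i / s"] assms(2,3) assms(4)[OF i] s
      by (cases "x i = 0") auto
    then have "x i / s * s powr p \<le> (x i / s) powr p * s powr p"
      by (rule mult_right_mono) simp
    then show "x i / s * s powr p \<le> x i powr p"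
      using s i assms(4) by (simp add: powr_mult[symmetric])
  qed
  finally show ?thesis by (simp add: s_def)
qed (use assms in \<open>simp add: sum_nonneg\<close>)

subsection \<open>Series\<close>

text \<open>Each block of m consecutive terms is at most m times its first term.\<close>

lemma summable_decseq_subseq:
  fixes h :: "nat \<Rightarrow> real"
  assumes "decseq h" "\<And>k. h k \<ge> 0" "m \<ge> 1" and sum: "summable (\<lambda>j. h (j * m))"
  shows "summable h"
proof (rule summableI_nonneg_bounded)
  fix k
  have "(\<Sum>i<k. h i) \<le> (\<Sum>i<k * m. h i)"
    using assms by (intro sum_mono2) auto
  also have "\<dots> = (\<Sum>j<k. \<Sum>i\<in>{j * m..<j * m + m}. h i)"
    by (rule sum.nat_group[symmetric])
  also have "\<dots> \<le> (\<Sum>j<k. \<Sum>i\<in>{j * m..<j * m + m}. h (j * m))"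
    using assms(1) by (intro sum_mono) (auto dest: decseqD)
  also have "\<dots> = real m * (\<Sum>j<k. h (j * m))"
    by (simp add: sum_distrib_left)
  also have "\<dots> \<le> real m * (\<Sum>j. h (j * m))"
    using assms by (intro mult_left_mono sum_le_suminf) auto
  finally show "(\<Sum>i<k. h i) \<le> real m * (\<Sum>j. h (j * m))" .
qed (use assms in auto)

text \<open>Condensation over powers of 2 turns the series into that of
  \<open>u (c * 2 powr (s * k))\<close>. Passing to every m-th index with s m >= 1, and shifting to
  absorb c, leaves a series dominated by the given one.\<close>

lemma summable_powr_condensed:
  fixes u :: "real \<Rightarrow> real"
  assumes anti: "\<And>x y. 0 \<le> x \<Longrightarrow> x \<le> y \<Longrightarrow> u y \<le> u x"
    and nonneg: "\<And>x. 0 \<le> x \<Longrightarrow> u x \<ge> 0"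
    and sum: "summable (\<lambda>n. u (2 ^ n))" and c: "c > 0" and s: "s > 0"
  shows "summable (\<lambda>n. u (c * real n powr s) / real n)"
proof -
  define h where "h = (\<lambda>k::nat. u (c * 2 powr (s * real k)))"
  have dec: "decseq h"
    unfolding h_def using c s by (intro decseq_SucI anti mult_left_mono powr_mono) auto
  obtain m :: nat where m: "m \<ge> 1" "1 \<le> s * real m"
  proof -
    obtain m :: nat where m: "1 / s \<le> real m" using real_arch_simple by blast
    then have "1 \<le> s * real m" using s by (simp add: field_simps)
    moreover from this have "m \<ge> 1" by (cases m) auto
    ultimately show ?thesis using that by blast
  qed
  \<comment> \<open>The shift makes c 2^j0 > 1, which compensates for a small c.\<close>
  obtain j0 :: nat where j0: "1 / c < 2 ^ j0" using real_arch_pow[of 2] by auto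
  have "summable (\<lambda>j. h ((j + j0) * m))"
  proof (rule summable_comparison_test_ev[OF always_eventually sum], intro allI)
    fix j
    have "2 ^ j \<le> c * 2 ^ j0 * 2 ^ j" using j0 c by (simp add: field_simps)
    also have "\<dots> = c * 2 powr (1 * real (j + j0))"
      by (simp add: powr_add powr_realpow mult_ac)
    also have "\<dots> \<le> c * 2 powr ((s * real m) * real (j + j0))"
      using m c by (intro mult_left_mono powr_mono mult_right_mono) auto
    finally have "u (c * 2 powr (s * real ((j + j0) * m))) \<le> u (2 ^ j)"
      by (intro anti) (simp_all add: mult_ac)
    then show "norm (h ((j + j0) * m)) \<le> u (2 ^ j)"
      using nonneg c by (simp add: h_def)
  qed
  then have "summable (\<lambda>j. h (j * m))" by (subst (asm) summable_iff_shift)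
  then have "summable h"
    using c by (intro summable_decseq_subseq[OF dec _ m(1)]) (auto simp: h_def nonneg)
  \<comment> \<open>\<open>h\<close> is exactly the condensed form of
    \<open>u (c * n powr s) / n\<close>: the factor 2^k cancels the denominator.\<close>
  also have "h = (\<lambda>k. 2 ^ k * (u (c * real (2 ^ k) powr s) / real (2 ^ k)))"
    by (auto simp: h_def powr_realpow[symmetric] powr_powr mult.commute)
  finally show ?thesis
  proof (subst condensation_test)
    fix m :: nat assume "0 < m"
    then show "u (c * real (Suc m) powr s) / real (Suc m) \<le> u (c * real m powr s) / real m"
      using c s by (intro frac_le anti nonneg mult_left_mono powr_mono2) auto
  qed (use c nonneg in auto)
qed

lemma summable_powr_exp:
  fixes a c \<eta> :: real
  assumes "c > 0" "\<eta> > 0"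
  shows "summable (\<lambda>n. real n powr a * (2 * exp (1 - c * real n powr \<eta>)))"
proof (rule summable_comparison_test_ev)
  show "summable (\<lambda>n. real n powr (-2))" by (subst summable_real_powr_iff) simp
  have "eventually (\<lambda>n::nat. real n powr a * (2 * exp (1 - c * real n powr \<eta>)) \<le> real n powr (-2)) at_top"
    using assms by real_asymp
  then show "\<forall>\<^sub>F n in sequentially.
      norm (real n powr a * (2 * exp (1 - c * real n powr \<eta>))) \<le> real n powr (-2)"
    by simp
qed

text \<open>This bounds by 1 the error terms in the Chernoff exponent for negatively associated
  variables.\<close>

lemma bounded_powr_ln:
  fixes a b C D :: real
  assumes "a < 0" "b < 0"
  shows "eventually (\<lambda>n::nat. C * real n powr a * ln (real n) + D * real n powr b * (ln (real n))\<^sup>2 \<le> 1) at_top"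
proof -
  have "((\<lambda>n::nat. C * real n powr a * ln (real n) + D * real n powr b * (ln (real n))\<^sup>2) \<longlongrightarrow> 0) at_top"
  proof -
    have "((\<lambda>n::nat. real n powr a * ln (real n)) \<longlongrightarrow> 0) at_top" using assms by real_asymp
    moreover have "((\<lambda>n::nat. real n powr b * (ln (real n))\<^sup>2) \<longlongrightarrow> 0) at_top" using assms by real_asymp
    ultimately show ?thesis
      using tendsto_add[OF tendsto_mult_left[of _ 0 _ C] tendsto_mult_left[of _ 0 _ D]]
      by (fastforce simp: mult.assoc)
  qed
  then have "eventually (\<lambda>n::nat. C * real n powr a * ln (real n) + D * real n powr b * (ln (real n))\<^sup>2 < 1) at_top"
    by (rule order_tendstoD) simp
  then show ?thesis by eventually_elim simp
qed

text \<open>The theorem speaks of \<open>summable_on\<close> from 1 on, whereas the comparison tests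
  are for \<open>summable\<close>, which includes index 0; a finite initial segment makes no
  difference.\<close>

lemma nonneg_summable_on_atLeast_iff:
  fixes g :: "nat \<Rightarrow> real"
  assumes "\<And>n. g n \<ge> 0"
  shows "g summable_on {k..} \<longleftrightarrow> summable g"
proof -
  have "g summable_on {k..} \<longleftrightarrow> g summable_on UNIV"
  proof
    assume "g summable_on {k..}"
    then have "g summable_on ({k..} \<union> {..<k})" by (intro summable_on_union) auto
    also have "{k..} \<union> {..<k} = UNIV" by auto
    finally show "g summable_on UNIV" .
  qed (auto intro: summable_on_subset_banach)
  also have "\<dots> \<longleftrightarrow> summable g"
    using assms by (rule summable_on_UNIV_nonneg_real_iff)
  finally show ?thesis .
qed

text \<open>At the level c n^(1/r), the Markov-type bounds carry n times the level to the power -p;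
  the weight cancels all powers of n in this except 1/n.\<close>

lemma powr_weight:
  fixes c x y :: real
  assumes "x > 0" "c > 0"
  shows "x powr (p / r - 2) * ((c * x powr (1 / r)) powr (- p) * (x * y)) = c powr (- p) * (y / x)"
proof -
  have "x powr (p / r - 2) * (x powr (- (p / r)) * x powr 1) = x powr (- 1)"
    unfolding powr_add[symmetric] by simp
  then have *: "x powr (p / r - 2) * (x powr (- (p / r)) * x) = 1 / x"
    using assms by (simp add: powr_minus_divide)
  have "(c * x powr (1 / r)) powr (- p) = c powr (- p) * x powr (- (p / r))"
    using assms by (simp add: powr_mult powr_powr)
  then have "x powr (p / r - 2) * ((c * x powr (1 / r)) powr (- p) * (x * y))
      = c powr (- p) * y * (x powr (p / r - 2) * (x powr (- (p / r)) * x))"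
    by (simp add: mult_ac)
  then show ?thesis unfolding * by simp
qed

subsection \<open>Maxima of partial sums of arbitrary variables\<close>

lemma max_partial_sum_gt_iff:
  assumes "n \<ge> 1"
  shows "max_partial_sum X n \<omega> > c \<longleftrightarrow> (\<exists>k\<in>{1..n}. \<bar>partial_sum X k \<omega>\<bar> > c)"
  unfolding max_partial_sum_def using assms by (subst Max_gr_iff) auto

lemma partial_sum_0 [simp]: "partial_sum X 0 \<omega> = 0"
  by (simp add: partial_sum_def)

lemma partial_sum_Suc [simp]: "partial_sum X (Suc k) \<omega> = partial_sum X k \<omega> + X (Suc k) \<omega>"
  by (simp add: partial_sum_def)

lemma measurable_partial_sum:
  assumes "\<And>i. 1 \<le> i \<Longrightarrow> i \<le> n \<Longrightarrow> X i \<in> borel_measurable M"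
  shows "partial_sum X n \<in> borel_measurable M"
  unfolding partial_sum_def[abs_def] using assms by (intro borel_measurable_sum) auto

lemma sets_max_partial_sum_gt:
  assumes "n \<ge> 1" "\<And>i. 1 \<le> i \<Longrightarrow> i \<le> n \<Longrightarrow> X i \<in> borel_measurable M"
  shows "{\<omega> \<in> space M. max_partial_sum X n \<omega> > c} \<in> sets M"
proof -
  have [measurable]: "partial_sum X k \<in> borel_measurable M" if "k \<in> {1..n}" for k
    using that assms(2) by (intro measurable_partial_sum) auto
  show ?thesis
    unfolding max_partial_sum_gt_iff[OF assms(1)] by measurable
qed

text \<open>No cancellation is available, so the partial sums are bounded by sums of |X_k|. The
  values up to b = c / (2n) account for at most c / 2; the large values must supply the rest, and
  Markov's inequality applies to the sum of their p-th powers.\<close>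

lemma (in prob_space) tail_bound_arbitrary:
  assumes p: "0 < p" "p \<le> 1" and c: "c > 0" and n: "n \<ge> 1"
    and meas: "\<And>k. k \<ge> 1 \<Longrightarrow> X k \<in> borel_measurable M"
    and int: "\<And>k. k \<ge> 1 \<Longrightarrow>
      integrable M (\<lambda>\<omega>. if c / (2 * real n) < \<bar>X k \<omega>\<bar> then \<bar>X k \<omega>\<bar> powr p else 0)"
    and le: "\<And>k. k \<ge> 1 \<Longrightarrow>
      (\<integral>\<omega>. (if c / (2 * real n) < \<bar>X k \<omega>\<bar> then \<bar>X k \<omega>\<bar> powr p else 0) \<partial>M) \<le> \<tau>"
  shows "prob {\<omega> \<in> space M. max_partial_sum X n \<omega> > c} \<le> (c / 2) powr (- p) * (real n * \<tau>)"
proof -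
  define b where "b = c / (2 * real n)"
  define V where "V = (\<lambda>k \<omega>. if b < \<bar>X k \<omega>\<bar> then \<bar>X k \<omega>\<bar> powr p else 0)"
  have int': "integrable M (V k)" and le': "(\<integral>\<omega>. V k \<omega> \<partial>M) \<le> \<tau>" if "k \<ge> 1" for k
    using int le that by (simp_all add: V_def b_def)
  have intS: "integrable M (\<lambda>\<omega>. \<Sum>k=1..n. V k \<omega>)" using int' by auto
  have "prob {\<omega> \<in> space M. max_partial_sum X n \<omega> > c}
    \<le> prob {\<omega> \<in> space M. (\<Sum>k=1..n. V k \<omega>) \<ge> (c / 2) powr p}"
  proof (rule finite_measure_mono)
    show "{\<omega> \<in> space M. max_partial_sum X n \<omega> > c}
      \<subseteq> {\<omega> \<in> space M. (\<Sum>k=1..n. V k \<omega>) \<ge> (c / 2) powr p}"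
    proof safe
      fix \<omega> assume "max_partial_sum X n \<omega> > c"
      then obtain m where m: "m \<in> {1..n}" "\<bar>partial_sum X m \<omega>\<bar> > c"
        unfolding max_partial_sum_gt_iff[OF n] by blast
      let ?W = "\<lambda>k. if b < \<bar>X k \<omega>\<bar> then \<bar>X k \<omega>\<bar> else 0"
      have "c < (\<Sum>k=1..m. \<bar>X k \<omega>\<bar>)"
        using m(2) sum_abs[of "\<lambda>k. X k \<omega>" "{1..m}"] unfolding partial_sum_def by linarith
      also have "\<dots> \<le> (\<Sum>k=1..n. \<bar>X k \<omega>\<bar>)"
        using m by (intro sum_mono2) auto
      \<comment> \<open>Each |X_k| is at most b plus its part above b, and n b = c / 2.\<close>
      also have "\<dots> \<le> (\<Sum>k=1..n. b + ?W k)"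
        using c by (intro sum_mono) (auto simp: b_def)
      also have "\<dots> = c / 2 + (\<Sum>k=1..n. ?W k)"
        using n by (simp add: sum.distrib b_def)
      finally have "c / 2 \<le> (\<Sum>k=1..n. ?W k)" by simp
      then have "(c / 2) powr p \<le> (\<Sum>k=1..n. ?W k) powr p"
        using p c by (intro powr_mono2) auto
      also have "\<dots> \<le> (\<Sum>k=1..n. ?W k powr p)"
        using p by (intro sum_le_powr_sum) auto
      also have "\<dots> = (\<Sum>k=1..n. V k \<omega>)"
        unfolding V_def using p by (intro sum.cong) auto
      finally show "(\<Sum>k=1..n. V k \<omega>) \<ge> (c / 2) powr p" .
    qed
  qed (use intS in measurable)
  also have "\<dots> \<le> (\<integral>\<omega>. (\<Sum>k=1..n. V k \<omega>) \<partial>M) / (c / 2) powr p"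
    by (rule integral_Markov_inequality_measure[OF intS, where A = "{}"])
      (use c in \<open>auto intro!: sum_nonneg simp: V_def\<close>)
  also have "(\<integral>\<omega>. (\<Sum>k=1..n. V k \<omega>) \<partial>M) = (\<Sum>k=1..n. (\<integral>\<omega>. V k \<omega> \<partial>M))"
    using int' by (intro Bochner_Integration.integral_sum) auto
  also have "\<dots> / (c / 2) powr p \<le> (\<Sum>k=1..n. \<tau>) / (c / 2) powr p"
    using le' by (intro divide_right_mono sum_mono) auto
  finally show ?thesis by (simp add: powr_minus_divide)
qed

subsection \<open>Martingale differences\<close>

fun stopped_sum :: "real \<Rightarrow> (nat \<Rightarrow> 'a \<Rightarrow> real) \<Rightarrow> nat \<Rightarrow> 'a \<Rightarrow> real" where
  "stopped_sum c D 0 \<omega> = 0"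
| "stopped_sum c D (Suc k) \<omega> =
     stopped_sum c D k \<omega> + (if \<bar>stopped_sum c D k \<omega>\<bar> \<le> c then D (Suc k) \<omega> else 0)"

text \<open>Once outside the interval the walk never moves, so being inside at time n means that it
  was never stopped. Used in the contrapositive: a partial sum beyond c leaves the stopped sum
  beyond c.\<close>

lemma stopped_sum_le_imp:
  assumes "\<bar>stopped_sum c D n \<omega>\<bar> \<le> c"
  shows "stopped_sum c D n \<omega> = partial_sum D n \<omega> \<and> (\<forall>k\<le>n. \<bar>partial_sum D k \<omega>\<bar> \<le> c)"
  using assms
proof (induction n)
  case 0
  then show ?case by simp
next
  case (Suc n)
  have *: "\<bar>stopped_sum c D n \<omega>\<bar> \<le> c"
  proof (rule ccontr)
    assume "\<not> ?thesis"
    then show False using Suc.prems by simp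
  qed
  then have eq: "stopped_sum c D (Suc n) \<omega> = partial_sum D (Suc n) \<omega>"
    using Suc.IH by simp
  have "\<bar>partial_sum D k \<omega>\<bar> \<le> c" if "k \<le> Suc n" for k
    using that Suc.IH[OF *] Suc.prems eq by (cases "k = Suc n") auto
  then show ?case using eq by blast
qed

section \<open>Orthogonality of increments and the maximal inequality\<close>

lemma (in prob_space) sigma_finite_subalgebra:
  assumes "subalgebra M G"
  shows "sigma_finite_subalgebra M G"
proof -
  have "finite_measure_subalgebra M G"
    by (simp add: finite_measure_subalgebra_def finite_measure_subalgebra_axioms_def
        assms finite_measure_axioms)
  then interpret finite_measure_subalgebra M G .
  show ?thesis by (rule sigma_finite_subalgebra_axioms)
qed

text \<open>The filtration is a parameter so that truncated and recentred sequences can be treated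
  over the same one.\<close>

locale martingale_difference = prob_space M for M :: "'a measure" +
  fixes F :: "nat \<Rightarrow> 'a measure" and D :: "nat \<Rightarrow> 'a \<Rightarrow> real"
  assumes filtration: "filtration (space M) F"
    and subalgebra: "\<And>n. subalgebra M (F n)"
    and integrable_D: "\<And>n. n \<ge> 1 \<Longrightarrow> integrable M (D n)"
    and adapted: "\<And>n. n \<ge> 1 \<Longrightarrow> D n \<in> borel_measurable (F n)"
    and cond_exp_zero: "\<And>n. n \<ge> 1 \<Longrightarrow> AE \<omega> in M. real_cond_exp M (F (n - 1)) (D n) \<omega> = 0"
begin

lemma measurable_F_mono:
  assumes "m \<le> n" "g \<in> borel_measurable (F m)"
  shows "g \<in> borel_measurable (F n)"
proof (rule measurable_from_subalg[OF _ assms(2)])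
  show "Conditional_Expectation.subalgebra (F n) (F m)"
    using filtration assms(1)
    by (auto simp: subalgebra_def filtration.space_F dest: filtration.sets_F_mono)
qed

lemma measurable_F_M: "g \<in> borel_measurable (F n) \<Longrightarrow> g \<in> borel_measurable M"
  by (rule measurable_from_subalg[OF subalgebra])

lemma measurable_D [measurable]: "D (Suc n) \<in> borel_measurable M"
  using adapted[of "Suc n"] measurable_F_M by auto

text \<open>A bounded factor known at time n comes out of the conditional expectation of
  \<open>D (Suc n)\<close>, which is zero. Boundedness makes the product integrable although
  \<open>D (Suc n)\<close> is only assumed integrable.\<close>

lemma orthogonal:
  assumes g: "g \<in> borel_measurable (F n)" and bound: "\<And>\<omega>. \<bar>g \<omega>\<bar> \<le> c"
  shows "integrable M (\<lambda>\<omega>. g \<omega> * D (Suc n) \<omega>)" "(\<integral>\<omega>. g \<omega> * D (Suc n) \<omega> \<partial>M) = 0"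
proof -
  interpret sub: sigma_finite_subalgebra M "F n" by (rule sigma_finite_subalgebra[OF subalgebra])
  have [measurable]: "g \<in> borel_measurable M" by (rule measurable_F_M[OF g])
  show int: "integrable M (\<lambda>\<omega>. g \<omega> * D (Suc n) \<omega>)"
  proof (rule Bochner_Integration.integrable_bound)
    show "integrable M (\<lambda>\<omega>. c * D (Suc n) \<omega>)"
      using integrable_D[of "Suc n"] by simp
    show "AE \<omega> in M. norm (g \<omega> * D (Suc n) \<omega>) \<le> norm (c * D (Suc n) \<omega>)"
      using bound by (auto simp: abs_mult intro!: mult_right_mono order_trans[OF bound])
  qed measurable
  have "(\<integral>\<omega>. g \<omega> * D (Suc n) \<omega> \<partial>M) = (\<integral>\<omega>. g \<omega> * real_cond_exp M (F n) (D (Suc n)) \<omega> \<partial>M)"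
    using sub.real_cond_exp_intg(2)[OF int g] by simp
  also have "\<dots> = (\<integral>\<omega>. 0 \<partial>M)"
    using cond_exp_zero[of "Suc n"] by (intro integral_cong_AE) auto
  finally show "(\<integral>\<omega>. g \<omega> * D (Suc n) \<omega> \<partial>M) = 0" by simp
qed

lemma measurable_partial_sum_F: "partial_sum D n \<in> borel_measurable (F n)"
proof (rule measurable_partial_sum)
  show "D i \<in> borel_measurable (F n)" if "1 \<le> i" "i \<le> n" for i
    by (rule measurable_F_mono[OF that(2) adapted[OF that(1)]])
qed

lemma measurable_stopped_sum_F: "stopped_sum c D n \<in> borel_measurable (F n)"
proof (induction n)
  case (Suc n)
  have [measurable]: "stopped_sum c D n \<in> borel_measurable (F (Suc n))"
    "D (Suc n) \<in> borel_measurable (F (Suc n))"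
    using Suc measurable_F_mono[of n "Suc n"] adapted by auto
  show ?case by simp
qed simp

lemma measurable_stopped_sum [measurable]: "stopped_sum c D n \<in> borel_measurable M"
  by (rule measurable_F_M[OF measurable_stopped_sum_F])

text \<open>Induction on n: before the exit, \<open>min_square_le_powr\<close> bounds the growth of
  the capped square and its linear term has mean zero; after the exit nothing changes.\<close>

lemma stopped_sum_bound:
  assumes p: "1 \<le> p" "p \<le> 2" and c: "c > 0"
    and int: "\<And>k. k \<ge> 1 \<Longrightarrow> integrable M (\<lambda>\<omega>. \<bar>D k \<omega>\<bar> powr p)"
  shows "(\<integral>\<omega>. min ((stopped_sum c D n \<omega>)\<^sup>2) (c\<^sup>2) \<partial>M)
    \<le> (4 * c) powr (2 - p) * (\<Sum>k=1..n. \<integral>\<omega>. \<bar>D k \<omega>\<bar> powr p \<partial>M)"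
proof (induction n)
  case (Suc n)
  define T where "T = stopped_sum c D n"
  \<comment> \<open>Equal to \<open>T\<close> while the walk is still moving, and bounded by c, as
    orthogonality requires.\<close>
  define g where "g = (\<lambda>\<omega>. if \<bar>T \<omega>\<bar> \<le> c then T \<omega> else 0)"
  have TF [measurable]: "T \<in> borel_measurable (F n)"
    unfolding T_def by (rule measurable_stopped_sum_F)
  have [measurable]: "T \<in> borel_measurable M" by (rule measurable_F_M[OF TF])
  have gF: "g \<in> borel_measurable (F n)" unfolding g_def by measurable
  have gb: "\<bar>g \<omega>\<bar> \<le> c" for \<omega> using c by (simp add: g_def)
  note orth = orthogonal[OF gF gb]
  have intG: "integrable M (\<lambda>\<omega>. min ((U \<omega>)\<^sup>2) (c\<^sup>2))" if [measurable]: "U \<in> borel_measurable M" for U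
    by (rule integrable_const_bound[where B = "c\<^sup>2"]) auto
  have "(\<integral>\<omega>. min ((stopped_sum c D (Suc n) \<omega>)\<^sup>2) (c\<^sup>2) \<partial>M)
    \<le> (\<integral>\<omega>. min ((T \<omega>)\<^sup>2) (c\<^sup>2) + 2 * (g \<omega> * D (Suc n) \<omega>)
          + (4 * c) powr (2 - p) * \<bar>D (Suc n) \<omega>\<bar> powr p \<partial>M)"
  proof (rule integral_mono)
    fix \<omega>
    show "min ((stopped_sum c D (Suc n) \<omega>)\<^sup>2) (c\<^sup>2)
      \<le> min ((T \<omega>)\<^sup>2) (c\<^sup>2) + 2 * (g \<omega> * D (Suc n) \<omega>)
          + (4 * c) powr (2 - p) * \<bar>D (Suc n) \<omega>\<bar> powr p"
    proof (cases "\<bar>T \<omega>\<bar> \<le> c")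
      case True
      then have "(T \<omega>)\<^sup>2 \<le> c\<^sup>2" using c by (simp add: abs_le_square_iff[symmetric])
      then show ?thesis
        using min_square_le_powr[OF True c p, of "D (Suc n) \<omega>"] True
        by (simp add: T_def[symmetric] g_def min_absorb1)
    qed (simp add: T_def[symmetric] g_def)
  next
    show "integrable M (\<lambda>\<omega>. min ((stopped_sum c D (Suc n) \<omega>)\<^sup>2) (c\<^sup>2))"
      by (rule intG) measurable
  qed (use intG orth(1) int in auto)
  also have "\<dots> = (\<integral>\<omega>. min ((T \<omega>)\<^sup>2) (c\<^sup>2) \<partial>M)
      + (4 * c) powr (2 - p) * (\<integral>\<omega>. \<bar>D (Suc n) \<omega>\<bar> powr p \<partial>M)"
    using intG orth int by simp
  finally show ?case using Suc.IH by (simp add: T_def[symmetric] algebra_simps)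
qed simp

text \<open>On the event the stopped sum is beyond c, so its capped square attains c^2; Markov's
  inequality then applies to the bound on the stopped walk.\<close>

lemma maximal_inequality:
  assumes p: "1 \<le> p" "p \<le> 2" and c: "c > 0" and n: "n \<ge> 1"
    and int: "\<And>k. k \<ge> 1 \<Longrightarrow> integrable M (\<lambda>\<omega>. \<bar>D k \<omega>\<bar> powr p)"
  shows "prob {\<omega> \<in> space M. max_partial_sum D n \<omega> > c}
    \<le> 4 * c powr (- p) * (\<Sum>k=1..n. \<integral>\<omega>. \<bar>D k \<omega>\<bar> powr p \<partial>M)"
proof -
  let ?G = "\<lambda>\<omega>. min ((stopped_sum c D n \<omega>)\<^sup>2) (c\<^sup>2)"
  let ?S = "\<Sum>k=1..n. \<integral>\<omega>. \<bar>D k \<omega>\<bar> powr p \<partial>M"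
  have S: "?S \<ge> 0" by (intro sum_nonneg) simp
  have "prob {\<omega> \<in> space M. max_partial_sum D n \<omega> > c} \<le> prob {\<omega> \<in> space M. ?G \<omega> \<ge> c\<^sup>2}"
  proof (rule finite_measure_mono)
    show "{\<omega> \<in> space M. max_partial_sum D n \<omega> > c} \<subseteq> {\<omega> \<in> space M. ?G \<omega> \<ge> c\<^sup>2}"
    proof safe
      fix \<omega> assume "max_partial_sum D n \<omega> > c"
      then have "\<bar>stopped_sum c D n \<omega>\<bar> > c"
        using stopped_sum_le_imp[of c D n \<omega>] unfolding max_partial_sum_gt_iff[OF n]
        by (meson atLeastAtMost_iff linorder_not_le)
      then show "?G \<omega> \<ge> c\<^sup>2"
        using c by (simp add: abs_le_square_iff[symmetric])
    qed
  qed measurable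
  also have "\<dots> \<le> (\<integral>\<omega>. ?G \<omega> \<partial>M) / c\<^sup>2"
    by (rule integral_Markov_inequality_measure[where A = "{}"])
      (use c in \<open>auto intro!: integrable_const_bound[where B = "c\<^sup>2"]\<close>)
  also have "\<dots> \<le> (4 * c) powr (2 - p) * ?S / c\<^sup>2"
    by (intro divide_right_mono stopped_sum_bound assms) auto
  also have "\<dots> = 4 powr (2 - p) * (c powr (- p) * ?S)"
    using c by (simp add: powr_mult powr_diff powr_minus powr_numeral field_simps)
  \<comment> \<open>Since p >= 1, 4^(2-p) <= 4.\<close>
  also have "\<dots> \<le> 4 powr 1 * (c powr (- p) * ?S)"
    using p c S by (intro mult_right_mono powr_mono) auto
  finally show ?thesis by simp
qed

section \<open>Exponential bounds for bounded martingale differences\<close>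

lemma exp_moment_bound:
  assumes B: "\<And>k. k \<ge> 1 \<Longrightarrow> AE \<omega> in M. \<bar>D k \<omega>\<bar> \<le> B" and t: "\<bar>t\<bar> * B \<le> 1"
  shows "integrable M (\<lambda>\<omega>. exp (t * partial_sum D n \<omega>)) \<and>
    (\<integral>\<omega>. exp (t * partial_sum D n \<omega>) \<partial>M) \<le> exp (real n * (t * B)\<^sup>2)"
proof -
  have [measurable]: "partial_sum D n \<in> borel_measurable M" for n
    by (rule measurable_F_M[OF measurable_partial_sum_F])
  have bnd: "AE \<omega> in M. \<bar>partial_sum D n \<omega>\<bar> \<le> real n * B" for n
  proof (induction n)
    case (Suc n)
    from Suc B[of "Suc n"] show ?case
      by (auto simp: algebra_simps intro!: abs_triangle_ineq[THEN order_trans])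
  qed simp
  have int: "integrable M (\<lambda>\<omega>. exp (t * partial_sum D n \<omega>))" for n
  proof (rule integrable_const_bound[where B = "exp (\<bar>t\<bar> * (real n * B))"])
    show "AE \<omega> in M. norm (exp (t * partial_sum D n \<omega>)) \<le> exp (\<bar>t\<bar> * (real n * B))"
      using bnd[of n]
    proof eventually_elim
      case (elim \<omega>)
      have "t * partial_sum D n \<omega> \<le> \<bar>t\<bar> * \<bar>partial_sum D n \<omega>\<bar>"
        by (metis abs_ge_self abs_mult)
      also have "\<dots> \<le> \<bar>t\<bar> * (real n * B)" using elim by (intro mult_left_mono) auto
      finally show ?case by simp
    qed
  qed measurable
  \<comment> \<open>Each step multiplies the expectation by at most 1 + (tB)^2 <= exp((tB)^2): bound
    the exponential of the new increment quadratically and discard the linear term by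
    orthogonality.\<close>
  have "(\<integral>\<omega>. exp (t * partial_sum D n \<omega>) \<partial>M) \<le> exp (real n * (t * B)\<^sup>2)"
  proof (induction n)
    case (Suc n)
    define E where "E = (\<lambda>\<omega>. exp (t * partial_sum D n \<omega>))"
    \<comment> \<open>The bound on the partial sums holds only almost everywhere, while
      \<open>orthogonal\<close> asks for one at every point; capping repairs this without changing
      the integrals.\<close>
    define E' where "E' = (\<lambda>\<omega>. min (E \<omega>) (exp (\<bar>t\<bar> * (real n * B))))"
    have EE': "AE \<omega> in M. E \<omega> = E' \<omega>"
      using bnd[of n]
    proof eventually_elim
      case (elim \<omega>)
      have "t * partial_sum D n \<omega> \<le> \<bar>t\<bar> * \<bar>partial_sum D n \<omega>\<bar>"
        by (metis abs_ge_self abs_mult)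
      also have "\<dots> \<le> \<bar>t\<bar> * (real n * B)" using elim by (intro mult_left_mono) auto
      finally show ?case by (simp add: E_def E'_def)
    qed
    have intE: "integrable M E" unfolding E_def by (rule int)
    then have intE': "integrable M E'"
      unfolding E'_def by (intro integrable_min) auto
    have F: "E' \<in> borel_measurable (F n)"
      using measurable_partial_sum_F[of n] unfolding E'_def E_def by measurable
    have E'b: "\<bar>E' \<omega>\<bar> \<le> exp (\<bar>t\<bar> * (real n * B))" for \<omega>
      by (auto simp: E'_def E_def)
    note orth = orthogonal[OF F E'b]
    have "(\<integral>\<omega>. exp (t * partial_sum D (Suc n) \<omega>) \<partial>M)
      \<le> (\<integral>\<omega>. (1 + (t * B)\<^sup>2) * E' \<omega> + t * (E' \<omega> * D (Suc n) \<omega>) \<partial>M)"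
    proof (rule integral_mono_AE[OF int])
      show "AE \<omega> in M. exp (t * partial_sum D (Suc n) \<omega>)
        \<le> (1 + (t * B)\<^sup>2) * E' \<omega> + t * (E' \<omega> * D (Suc n) \<omega>)"
        using EE' B[of "Suc n", simplified]
      proof eventually_elim
        case (elim \<omega>)
        have tD: "\<bar>t * D (Suc n) \<omega>\<bar> \<le> \<bar>t\<bar> * B"
          using elim by (simp add: abs_mult mult_left_mono)
        then have "(t * D (Suc n) \<omega>)\<^sup>2 \<le> (t * B)\<^sup>2"
          using power_mono[OF tD, of 2] by (simp add: power_mult_distrib)
        then have "exp (t * D (Suc n) \<omega>) \<le> 1 + t * D (Suc n) \<omega> + (t * B)\<^sup>2"
          using exp_le_quadratic[of "t * D (Suc n) \<omega>"] tD t by linarith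
        then have "E \<omega> * exp (t * D (Suc n) \<omega>) \<le> E \<omega> * (1 + t * D (Suc n) \<omega> + (t * B)\<^sup>2)"
          by (intro mult_left_mono) (auto simp: E_def)
        then show ?case
          unfolding elim(1) by (simp add: elim(1)[symmetric] E_def distrib_left exp_add algebra_simps)
      qed
    qed (use intE' orth in auto)
    also have "\<dots> = (1 + (t * B)\<^sup>2) * (\<integral>\<omega>. E' \<omega> \<partial>M)"
      using intE' orth by simp
    also have "(\<integral>\<omega>. E' \<omega> \<partial>M) = (\<integral>\<omega>. E \<omega> \<partial>M)"
      using EE' intE intE' by (intro integral_cong_AE) auto
    also have "(1 + (t * B)\<^sup>2) * (\<integral>\<omega>. E \<omega> \<partial>M) \<le> exp ((t * B)\<^sup>2) * exp (real n * (t * B)\<^sup>2)"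
      using Suc.IH exp_ge_add_one_self[of "(t * B)\<^sup>2"]
      by (intro mult_mono) (auto simp: E_def)
    finally show ?case by (simp add: exp_add[symmetric] algebra_simps)
  qed (simp add: prob_space)
  with int show ?thesis by blast
qed

text \<open>An exponent linear in x suffices: in the application x / (B sqrt n) is a positive
  constant times a positive power of n.\<close>

lemma exp_tail_bound:
  assumes B: "\<And>k. k \<ge> 1 \<Longrightarrow> AE \<omega> in M. \<bar>D k \<omega>\<bar> \<le> B" "B > 0"
    and n: "n \<ge> 1" and k: "k \<le> n"
  shows "prob {\<omega> \<in> space M. \<bar>partial_sum D k \<omega>\<bar> \<ge> x} \<le> 2 * exp (1 - x / (B * sqrt n))"
proof -
  have [measurable]: "partial_sum D n \<in> borel_measurable M" for n
    by (rule measurable_F_M[OF measurable_partial_sum_F])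
  have one: "prob {\<omega> \<in> space M. s * partial_sum D k \<omega> \<ge> x} \<le> exp (1 - x / (B * sqrt n))"
    if s: "\<bar>s\<bar> = 1" for s
  proof -
    \<comment> \<open>This choice makes n (tB)^2 = 1, so the exponential moment is at most e. The
      sign s treats both tails at once.\<close>
    define t where "t = 1 / (B * sqrt n)"
    have t: "t > 0" "t * B = 1 / sqrt n" using B(2) n by (auto simp: t_def)
    have st: "\<bar>s * t\<bar> * B \<le> 1" "(s * t * B)\<^sup>2 = 1 / n"
    proof -
      show "\<bar>s * t\<bar> * B \<le> 1" using s t n by (simp add: abs_mult)
      have "s\<^sup>2 = 1" using s by (metis one_power2 power2_abs)
      have "(s * t * B)\<^sup>2 = s\<^sup>2 * (t * B)\<^sup>2" by (simp add: power_mult_distrib)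
      then show "(s * t * B)\<^sup>2 = 1 / n"
        using \<open>s\<^sup>2 = 1\<close> t(2) by (simp add: power_divide)
    qed
    note E = exp_moment_bound[OF B(1) st(1), of k, simplified, unfolded st(2)]
    have "prob {\<omega> \<in> space M. s * partial_sum D k \<omega> \<ge> x}
        = prob {\<omega> \<in> space M. exp (s * t * partial_sum D k \<omega>) \<ge> exp (t * x)}"
      using t by (intro arg_cong[where f = prob]) (auto simp: mult.assoc mult.left_commute[of s])
    also have "\<dots> \<le> (\<integral>\<omega>. exp (s * t * partial_sum D k \<omega>) \<partial>M) / exp (t * x)"
      using E by (intro integral_Markov_inequality_measure[where A = "{}"]) auto
    also have "\<dots> \<le> exp 1 / exp (t * x)"
    proof (rule divide_right_mono)
      have "real k * (1 / real n) \<le> 1" using k n by simp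
      then show "(\<integral>\<omega>. exp (s * t * partial_sum D k \<omega>) \<partial>M) \<le> exp 1"
        using E by (meson exp_le_cancel_iff order_trans)
    qed simp
    finally show ?thesis by (simp add: exp_diff t_def)
  qed
  have "prob {\<omega> \<in> space M. \<bar>partial_sum D k \<omega>\<bar> \<ge> x}
    \<le> prob ({\<omega> \<in> space M. 1 * partial_sum D k \<omega> \<ge> x} \<union> {\<omega> \<in> space M. (-1) * partial_sum D k \<omega> \<ge> x})"
    by (rule finite_measure_mono) (auto simp: abs_if split: if_splits)
  also have "\<dots> \<le> prob {\<omega> \<in> space M. 1 * partial_sum D k \<omega> \<ge> x}
      + prob {\<omega> \<in> space M. (-1) * partial_sum D k \<omega> \<ge> x}"
    by (rule measure_Un_le) measurable
  also have "\<dots> \<le> 2 * exp (1 - x / (B * sqrt n))"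
    using one[of 1] one[of "-1"] by simp
  finally show ?thesis .
qed

end

section \<open>Truncation and conditional recentring\<close>

lemma martingale_difference_centered:
  assumes "prob_space M" "filtration (space M) F" "\<And>n. subalgebra M (F n)"
    and int: "\<And>n. n \<ge> 1 \<Longrightarrow> integrable M (V n)"
    and meas: "\<And>n. n \<ge> 1 \<Longrightarrow> V n \<in> borel_measurable (F n)"
  shows "martingale_difference M F (\<lambda>n \<omega>. V n \<omega> - real_cond_exp M (F (n - 1)) (V n) \<omega>)"
proof -
  interpret prob_space M by fact
  show ?thesis
  proof
    fix n :: nat assume n: "n \<ge> 1"
    interpret sub: sigma_finite_subalgebra M "F (n - 1)"
      by (rule sigma_finite_subalgebra[OF assms(3)])
    have sFF: "subalgebra (F n) (F (n - 1))"
      using assms(2) filtration.sets_F_mono[OF assms(2), of "n - 1" n]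
      by (auto simp: subalgebra_def filtration.space_F)
    let ?C = "real_cond_exp M (F (n - 1)) (V n)"
    note intC = sub.real_cond_exp_int(1)[OF int[OF n]]
    show "integrable M (\<lambda>\<omega>. V n \<omega> - ?C \<omega>)"
      by (rule Bochner_Integration.integrable_diff[OF int[OF n] intC])
    have "?C \<in> borel_measurable (F n)"
      by (rule measurable_from_subalg[OF sFF borel_measurable_cond_exp])
    then show "(\<lambda>\<omega>. V n \<omega> - ?C \<omega>) \<in> borel_measurable (F n)"
      using meas[OF n] by simp
    have "AE \<omega> in M. real_cond_exp M (F (n - 1)) (\<lambda>\<omega>. V n \<omega> - ?C \<omega>) \<omega>
        = ?C \<omega> - real_cond_exp M (F (n - 1)) ?C \<omega>"
      by (rule sub.real_cond_exp_diff[OF int[OF n] intC])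
    moreover have "AE \<omega> in M. real_cond_exp M (F (n - 1)) ?C \<omega> = ?C \<omega>"
      by (rule sub.real_cond_exp_F_meas[OF intC borel_measurable_cond_exp])
    ultimately show "AE \<omega> in M. real_cond_exp M (F (n - 1)) (\<lambda>\<omega>. V n \<omega> - ?C \<omega>) \<omega> = 0"
      by eventually_elim simp
  qed (use assms(3) filtration.space_F[OF assms(2)] filtration.sets_F_mono[OF assms(2)] in auto)
qed

text \<open>Jensen's inequality makes conditional expectation a contraction in L^p. The constant is
  the 2^p of the crude bound on |a + b|^p, times 2 for the two terms.\<close>

lemma (in sigma_finite_subalgebra) centered_powr_bound:
  assumes "p \<ge> 1" and int: "integrable M V" "integrable M (\<lambda>\<omega>. \<bar>V \<omega>\<bar> powr p)"
    and "finite_measure M"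
  shows "integrable M (\<lambda>\<omega>. \<bar>V \<omega> - real_cond_exp M F V \<omega>\<bar> powr p)"
    and "(\<integral>\<omega>. \<bar>V \<omega> - real_cond_exp M F V \<omega>\<bar> powr p \<partial>M)
      \<le> 2 powr (p + 1) * (\<integral>\<omega>. \<bar>V \<omega>\<bar> powr p \<partial>M)"
proof -
  interpret finite_measure M by fact
  let ?C = "real_cond_exp M F V"
  have [measurable]: "V \<in> borel_measurable M" using int by simp
  note convex = convex_on_abs_powr[OF \<open>p \<ge> 1\<close>]
  have intC: "integrable M (\<lambda>\<omega>. \<bar>?C \<omega>\<bar> powr p)"
    by (rule integrable_convex_cond_exp[where I = UNIV, OF int(1) _ _ int(2) convex]) auto
  have "AE \<omega> in M. \<bar>?C \<omega>\<bar> powr p \<le> real_cond_exp M F (\<lambda>\<omega>. \<bar>V \<omega>\<bar> powr p) \<omega>"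
    by (rule real_cond_exp_jensens_inequality(2)[where I = UNIV, OF int(1) _ _ int(2) convex]) auto
  then have "(\<integral>\<omega>. \<bar>?C \<omega>\<bar> powr p \<partial>M) \<le> (\<integral>\<omega>. real_cond_exp M F (\<lambda>\<omega>. \<bar>V \<omega>\<bar> powr p) \<omega> \<partial>M)"
    by (intro integral_mono_AE intC real_cond_exp_int int(2))
  also have "\<dots> = (\<integral>\<omega>. \<bar>V \<omega>\<bar> powr p \<partial>M)" by (rule real_cond_exp_int(2)[OF int(2)])
  finally have le: "(\<integral>\<omega>. \<bar>?C \<omega>\<bar> powr p \<partial>M) \<le> (\<integral>\<omega>. \<bar>V \<omega>\<bar> powr p \<partial>M)" .
  have pw: "\<bar>V \<omega> - ?C \<omega>\<bar> powr p \<le> 2 powr p * (\<bar>V \<omega>\<bar> powr p + \<bar>?C \<omega>\<bar> powr p)" for \<omega>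
    using abs_add_powr_le[of p "V \<omega>" "- ?C \<omega>"] assms by simp
  have intR: "integrable M (\<lambda>\<omega>. 2 powr p * (\<bar>V \<omega>\<bar> powr p + \<bar>?C \<omega>\<bar> powr p))"
    using intC int by simp
  show I: "integrable M (\<lambda>\<omega>. \<bar>V \<omega> - ?C \<omega>\<bar> powr p)"
    by (rule Bochner_Integration.integrable_bound[OF intR])
      (use pw in \<open>auto intro!: order_trans[OF pw]\<close>)
  have "(\<integral>\<omega>. \<bar>V \<omega> - ?C \<omega>\<bar> powr p \<partial>M) \<le> (\<integral>\<omega>. 2 powr p * (\<bar>V \<omega>\<bar> powr p + \<bar>?C \<omega>\<bar> powr p) \<partial>M)"
    by (intro integral_mono I intR pw)
  also have "\<dots> = 2 powr p * ((\<integral>\<omega>. \<bar>V \<omega>\<bar> powr p \<partial>M) + (\<integral>\<omega>. \<bar>?C \<omega>\<bar> powr p \<partial>M))"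
    using intC int by simp
  also have "\<dots> \<le> 2 powr p * (2 * (\<integral>\<omega>. \<bar>V \<omega>\<bar> powr p \<partial>M))"
    using le by (intro mult_left_mono) auto
  finally show "(\<integral>\<omega>. \<bar>V \<omega> - ?C \<omega>\<bar> powr p \<partial>M) \<le> 2 powr (p + 1) * (\<integral>\<omega>. \<bar>V \<omega>\<bar> powr p \<partial>M)"
    by (simp add: powr_add)
qed

text \<open>Cut each difference at b and recentre both parts conditionally. The small part gets the
  exponential bound with a union over k, the large part the maximal inequality; each may use half of
  c.\<close>

lemma (in martingale_difference) tail_bound:
  assumes p: "1 \<le> p" "p \<le> 2" and b: "b > 0" and c: "c > 0" and n: "n \<ge> 1"
    and int: "\<And>k. k \<ge> 1 \<Longrightarrow> integrable M (\<lambda>\<omega>. if b < \<bar>D k \<omega>\<bar> then \<bar>D k \<omega>\<bar> powr p else 0)"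
    and le: "\<And>k. k \<ge> 1 \<Longrightarrow> (\<integral>\<omega>. (if b < \<bar>D k \<omega>\<bar> then \<bar>D k \<omega>\<bar> powr p else 0) \<partial>M) \<le> \<tau>"
  shows "prob {\<omega> \<in> space M. max_partial_sum D n \<omega> > c}
    \<le> real n * (2 * exp (1 - c / (4 * b * sqrt n)))
      + 4 * (c / 2) powr (- p) * (real n * (2 powr (p + 1) * \<tau>))"
proof -
  define V where "V = (\<lambda>k \<omega>. if b < \<bar>D k \<omega>\<bar> then D k \<omega> else 0)"
  define U where "U = (\<lambda>k \<omega>. if b < \<bar>D k \<omega>\<bar> then 0 else D k \<omega>)"
  let ?C = "\<lambda>W n. real_cond_exp M (F (n - 1)) (W n)"
  define Y where "Y = (\<lambda>k \<omega>. U k \<omega> - ?C U k \<omega>)"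
  define Z where "Z = (\<lambda>k \<omega>. V k \<omega> - ?C V k \<omega>)"
  have adV: "V k \<in> borel_measurable (F k)" and adU: "U k \<in> borel_measurable (F k)" if "k \<ge> 1" for k
    using adapted[OF that] unfolding V_def U_def by measurable
  have mV: "V k \<in> borel_measurable M" and mU: "U k \<in> borel_measurable M" if "k \<ge> 1" for k
    using adV adU measurable_F_M that by blast+
  have iV: "integrable M (V k)" if k: "k \<ge> 1" for k
    by (rule Bochner_Integration.integrable_bound[OF integrable_D[OF k] mV[OF k]]) (auto simp: V_def)
  have iU: "integrable M (U k)" if k: "k \<ge> 1" for k
    by (rule Bochner_Integration.integrable_bound[OF integrable_D[OF k] mU[OF k]]) (auto simp: U_def)
  interpret Y: martingale_difference M F Y
    unfolding Y_def by (rule martingale_difference_centered)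
      (use filtration subalgebra iU adU prob_space_axioms in auto)
  interpret Z: martingale_difference M F Z
    unfolding Z_def by (rule martingale_difference_centered)
      (use filtration subalgebra iV adV prob_space_axioms in auto)
  \<comment> \<open>The two conditional means add up to that of \<open>D k\<close>, hence cancel
    almost everywhere.\<close>
  have decomp: "AE \<omega> in M. D k \<omega> = Y k \<omega> + Z k \<omega>" if k: "k \<ge> 1" for k
  proof -
    interpret sub: sigma_finite_subalgebra M "F (k - 1)" by (rule sigma_finite_subalgebra[OF subalgebra])
    have UV: "(\<lambda>\<omega>. U k \<omega> + V k \<omega>) = D k" by (auto simp: U_def V_def)
    have "AE \<omega> in M. real_cond_exp M (F (k - 1)) (D k) \<omega> = ?C U k \<omega> + ?C V k \<omega>"
      using sub.real_cond_exp_add[OF iU[OF k] iV[OF k]] unfolding UV .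
    with cond_exp_zero[OF k] show ?thesis
    proof eventually_elim
      case (elim \<omega>)
      then show ?case using fun_cong[OF UV, of \<omega>] by (simp add: Y_def Z_def)
    qed
  qed
  \<comment> \<open>The conditional mean of the small part also lies in [-b, b], so recentring at
    most doubles the bound.\<close>
  have Yb: "AE \<omega> in M. \<bar>Y k \<omega>\<bar> \<le> 2 * b" if k: "k \<ge> 1" for k
  proof -
    interpret sub: sigma_finite_subalgebra M "F (k - 1)" by (rule sigma_finite_subalgebra[OF subalgebra])
    have Ub: "U k \<omega> \<le> b" "U k \<omega> \<ge> - b" for \<omega> using b by (auto simp: U_def)
    have "AE \<omega> in M. ?C U k \<omega> \<le> b"
      by (rule sub.real_cond_exp_le_c[OF iU[OF k]]) (simp add: Ub)
    moreover have "AE \<omega> in M. ?C U k \<omega> \<ge> - b"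
      by (rule sub.real_cond_exp_ge_c[OF iU[OF k]]) (simp add: Ub)
    ultimately show ?thesis
    proof eventually_elim
      case (elim \<omega>)
      moreover have "\<bar>U k \<omega>\<bar> \<le> b" using b by (auto simp: U_def)
      ultimately show ?case by (auto simp: Y_def)
    qed
  qed
  have Vp: "\<bar>V k \<omega>\<bar> powr p = (if b < \<bar>D k \<omega>\<bar> then \<bar>D k \<omega>\<bar> powr p else 0)" for k \<omega>
    using p by (auto simp: V_def)
  have iZ: "integrable M (\<lambda>\<omega>. \<bar>Z k \<omega>\<bar> powr p)"
    and eZ: "(\<integral>\<omega>. \<bar>Z k \<omega>\<bar> powr p \<partial>M) \<le> 2 powr (p + 1) * \<tau>" if k: "k \<ge> 1" for k
  proof -
    interpret sub: sigma_finite_subalgebra M "F (k - 1)" by (rule sigma_finite_subalgebra[OF subalgebra])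
    have iVp: "integrable M (\<lambda>\<omega>. \<bar>V k \<omega>\<bar> powr p)" unfolding Vp by (rule int[OF k])
    note bnd = sub.centered_powr_bound[OF p(1) iV[OF k] iVp finite_measure_axioms]
    show "integrable M (\<lambda>\<omega>. \<bar>Z k \<omega>\<bar> powr p)" unfolding Z_def by (rule bnd(1))
    have "(\<integral>\<omega>. \<bar>Z k \<omega>\<bar> powr p \<partial>M) \<le> 2 powr (p + 1) * (\<integral>\<omega>. \<bar>V k \<omega>\<bar> powr p \<partial>M)"
      unfolding Z_def by (rule bnd(2))
    also have "\<dots> \<le> 2 powr (p + 1) * \<tau>"
      unfolding Vp by (intro mult_left_mono le k) auto
    finally show "(\<integral>\<omega>. \<bar>Z k \<omega>\<bar> powr p \<partial>M) \<le> 2 powr (p + 1) * \<tau>" .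
  qed
  define EY where "EY = (\<lambda>k. {\<omega> \<in> space M. \<bar>partial_sum Y k \<omega>\<bar> \<ge> c / 2})"
  define EZ where "EZ = {\<omega> \<in> space M. max_partial_sum Z n \<omega> > c / 2}"
  have mEY: "EY k \<in> events" for k
    using Y.measurable_F_M[OF Y.measurable_partial_sum_F[of k]] unfolding EY_def by measurable
  have mY: "Y k \<in> borel_measurable M" and mZ: "Z k \<in> borel_measurable M" if "k \<ge> 1" for k
    using Y.measurable_D[of "k - 1"] Z.measurable_D[of "k - 1"] that by auto
  have mEZ: "EZ \<in> events" unfolding EZ_def using mZ by (intro sets_max_partial_sum_gt n) auto
  let ?G = "\<lambda>\<omega>. \<forall>k\<in>{1..n}. D k \<omega> = Y k \<omega> + Z k \<omega>"
  have incl: "\<omega> \<in> (\<Union>k\<in>{1..n}. EY k) \<union> EZ"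
    if G: "?G \<omega>" and A: "\<omega> \<in> {\<omega> \<in> space M. max_partial_sum D n \<omega> > c}" for \<omega>
  proof -
    have \<omega>: "\<omega> \<in> space M" and "max_partial_sum D n \<omega> > c" using A by simp_all
    then obtain k where k: "k \<in> {1..n}" "\<bar>partial_sum D k \<omega>\<bar> > c"
      unfolding max_partial_sum_gt_iff[OF n] by (elim bexE)
    have "partial_sum D k \<omega> = partial_sum Y k \<omega> + partial_sum Z k \<omega>"
      unfolding partial_sum_def sum.distrib[symmetric] using G k(1) by (intro sum.cong) auto
    then have "\<bar>partial_sum Y k \<omega>\<bar> \<ge> c / 2 \<or> \<bar>partial_sum Z k \<omega>\<bar> > c / 2"
      using k(2) by linarith
    then show ?thesis
    proof
      assume "\<bar>partial_sum Y k \<omega>\<bar> \<ge> c / 2"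
      then have "\<omega> \<in> EY k" using \<omega> by (simp add: EY_def)
      then show ?thesis using k(1) by (intro UnI1 UN_I)
    next
      assume "\<bar>partial_sum Z k \<omega>\<bar> > c / 2"
      then have "max_partial_sum Z n \<omega> > c / 2"
        unfolding max_partial_sum_gt_iff[OF n] using k(1) by (rule bexI)
      then have "\<omega> \<in> EZ" using \<omega> by (simp add: EZ_def)
      then show ?thesis by (rule UnI2)
    qed
  qed
  \<comment> \<open>The decomposition holds almost everywhere, for finitely many k at once, so the
    events are compared up to a null set.\<close>
  have "AE \<omega> in M. ?G \<omega>"
    using decomp by (intro AE_finite_allI) auto
  then have "AE \<omega> in M. \<omega> \<in> {\<omega> \<in> space M. max_partial_sum D n \<omega> > c} \<longrightarrow> \<omega> \<in> (\<Union>k\<in>{1..n}. EY k) \<union> EZ"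
    by (rule eventually_mono) (use incl in blast)
  then have "prob {\<omega> \<in> space M. max_partial_sum D n \<omega> > c} \<le> prob ((\<Union>k\<in>{1..n}. EY k) \<union> EZ)"
    using mEY mEZ by (intro finite_measure_mono_AE) auto
  also have "\<dots> \<le> prob (\<Union>k\<in>{1..n}. EY k) + prob EZ"
    using mEY mEZ by (intro measure_Un_le) auto
  also have "prob (\<Union>k\<in>{1..n}. EY k) \<le> (\<Sum>k\<in>{1..n}. prob (EY k))"
    using mEY by (intro finite_measure_subadditive_finite) auto
  also have "\<dots> \<le> (\<Sum>k\<in>{1..n}. 2 * exp (1 - c / 2 / (2 * b * sqrt n)))"
    unfolding EY_def using b n by (intro sum_mono Y.exp_tail_bound Yb) auto
  also have "prob EZ \<le> 4 * (c / 2) powr (- p) * (\<Sum>k=1..n. \<integral>\<omega>. \<bar>Z k \<omega>\<bar> powr p \<partial>M)"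
    unfolding EZ_def using c n p iZ by (intro Z.maximal_inequality) auto
  also have "\<dots> \<le> 4 * (c / 2) powr (- p) * (\<Sum>k=1..n. 2 powr (p + 1) * \<tau>)"
    using eZ by (intro mult_left_mono sum_mono) auto
  finally show ?thesis by (simp add: mult.assoc)
qed

subsection \<open>Negatively associated variables\<close>

text \<open>Clipping is monotone, unlike replacing large values by 0; negative association speaks
  only about monotone functions.\<close>

definition clip :: "real \<Rightarrow> real \<Rightarrow> real" where
  "clip B x = max (- B) (min B x)"

lemma clip_mono: "x \<le> y \<Longrightarrow> clip B x \<le> clip B y"
  by (auto simp: clip_def)

lemma abs_clip_le: "B \<ge> 0 \<Longrightarrow> \<bar>clip B x\<bar> \<le> B"
  by (auto simp: clip_def)

lemma measurable_clip [measurable]: "clip B \<in> borel_measurable borel"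
  unfolding clip_def[abs_def] by measurable

lemma clip_eq: "\<bar>x\<bar> \<le> B \<Longrightarrow> clip B x = x"
  by (auto simp: clip_def)

lemma abs_clip_le_abs: "B \<ge> 0 \<Longrightarrow> \<bar>clip B x\<bar> \<le> \<bar>x\<bar>"
  by (auto simp: clip_def)

text \<open>Induction on n: the product of the first n factors and the last factor are functions of
  disjoint index sets, monotone in the same direction, so their covariance is at most 0. The bounds
  on \<phi> make the covariance exist.\<close>

lemma (in prob_space) neg_associated_expectation_prod_le:
  fixes X :: "nat \<Rightarrow> 'a \<Rightarrow> real" and \<phi> :: "real \<Rightarrow> real"
  assumes na: "neg_associated M X {1..}"
    and meas: "\<And>k. k \<ge> 1 \<Longrightarrow> X k \<in> borel_measurable M"
    and \<phi>: "mono \<phi> \<or> antimono \<phi>" "\<And>x. 0 \<le> \<phi> x" "\<And>x. \<phi> x \<le> C"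
      "\<phi> \<in> borel_measurable borel"
  shows "expectation (\<lambda>\<omega>. \<Prod>k=1..n. \<phi> (X k \<omega>)) \<le> (\<Prod>k=1..n. expectation (\<lambda>\<omega>. \<phi> (X k \<omega>)))"
proof (induction n)
  case (Suc n)
  have [measurable]: "(\<lambda>\<omega>. \<phi> (X k \<omega>)) \<in> borel_measurable M" if "k \<ge> 1" for k
    using measurable_compose[OF meas[OF that] \<phi>(4)] .
  define P where "P = (\<lambda>\<omega>. \<Prod>k=1..n. \<phi> (X k \<omega>))"
  define Q where "Q = (\<lambda>\<omega>. \<phi> (X (Suc n) \<omega>))"
  have [measurable]: "P \<in> borel_measurable M" "Q \<in> borel_measurable M"
    unfolding P_def Q_def by (auto intro!: borel_measurable_prod)
  have Pb: "0 \<le> P \<omega>" "P \<omega> \<le> C ^ n" for \<omega>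
    unfolding P_def using \<phi>(2,3) prod_mono[of "{1..n}" "\<lambda>k. \<phi> (X k \<omega>)" "\<lambda>_. C"]
    by (auto intro!: prod_nonneg)
  have Qb: "0 \<le> Q \<omega>" "Q \<omega> \<le> C" for \<omega> using \<phi>(2,3) by (auto simp: Q_def)
  have int: "integrable M P" "integrable M Q" "integrable M (\<lambda>\<omega>. P \<omega> * Q \<omega>)"
  proof -
    show "integrable M P" using Pb by (intro integrable_const_bound[where B = "C ^ n"]) auto
    show "integrable M Q" using Qb by (intro integrable_const_bound[where B = C]) auto
    show "integrable M (\<lambda>\<omega>. P \<omega> * Q \<omega>)"
    proof (rule integrable_const_bound[where B = "C ^ n * C"])
      have "\<bar>P \<omega> * Q \<omega>\<bar> \<le> C ^ n * C" for \<omega>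
        using mult_mono[OF Pb(2)[of \<omega>] Qb(2)[of \<omega>] order_trans[OF Pb] Qb(1)] Pb(1) Qb(1) by simp
      then show "AE \<omega> in M. norm (P \<omega> * Q \<omega>) \<le> C ^ n * C" by simp
    qed measurable
  qed
  \<comment> \<open>In the antimonotone case both functions are negated to become non-decreasing;
    since s^2 = 1 the covariance is unaffected.\<close>
  define s :: real where "s = (if mono \<phi> then 1 else -1)"
  have s: "s * s = 1" by (simp add: s_def)
  have sP: "mono_on ({1..n} \<rightarrow>\<^sub>E UNIV) (\<lambda>x. s * (\<Prod>k=1..n. \<phi> (x k)))"
  proof (rule mono_onI)
    fix x y :: "nat \<Rightarrow> real" assume le: "x \<le> y"
    show "s * (\<Prod>k=1..n. \<phi> (x k)) \<le> s * (\<Prod>k=1..n. \<phi> (y k))"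
    proof (cases "mono \<phi>")
      case True
      then have "\<phi> (x k) \<le> \<phi> (y k)" for k using le by (auto simp: le_fun_def dest: monoD)
      then show ?thesis using True \<phi>(2) by (simp add: s_def prod_mono)
    next
      case False
      then have "\<phi> (y k) \<le> \<phi> (x k)" for k
        using le \<phi>(1) by (auto simp: le_fun_def dest: antimonoD)
      then show ?thesis using False \<phi>(2) by (simp add: s_def prod_mono)
    qed
  qed
  have sQ: "mono_on ({Suc n} \<rightarrow>\<^sub>E UNIV) (\<lambda>x. s * \<phi> (x (Suc n)))"
  proof (rule mono_onI)
    fix x y :: "nat \<Rightarrow> real" assume "x \<le> y"
    then have "x (Suc n) \<le> y (Suc n)" by (simp add: le_fun_def)
    then show "s * \<phi> (x (Suc n)) \<le> s * \<phi> (y (Suc n))"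
      using \<phi>(1) by (cases "mono \<phi>") (auto simp: s_def dest: monoD antimonoD)
  qed
  have "neg_associated_finite M X {1..Suc n}"
    using na unfolding neg_associated_def by auto
  note na' = this[unfolded neg_associated_finite_def Let_def, rule_format, OF _ _ _ sP sQ]
  have "(\<lambda>\<omega>. s * (\<Prod>k=1..n. \<phi> ((\<lambda>i\<in>{1..n}. X i \<omega>) k))) = (\<lambda>\<omega>. s * P \<omega>)"
    unfolding P_def by (intro ext arg_cong[where f = "\<lambda>z. s * z"] prod.cong) auto
  moreover have "(\<lambda>\<omega>. s * \<phi> ((\<lambda>j\<in>{Suc n}. X j \<omega>) (Suc n))) = (\<lambda>\<omega>. s * Q \<omega>)"
    by (simp add: Q_def)
  ultimately have "covariance_exists M (\<lambda>\<omega>. s * P \<omega>) (\<lambda>\<omega>. s * Q \<omega>) \<longrightarrow>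
      covariance M (\<lambda>\<omega>. s * P \<omega>) (\<lambda>\<omega>. s * Q \<omega>) \<le> 0"
    using na' by simp
  moreover have eq: "(\<lambda>\<omega>. s * P \<omega> * (s * Q \<omega>)) = (\<lambda>\<omega>. P \<omega> * Q \<omega>)"
    using s by (auto simp: s_def)
  ultimately have "expectation (\<lambda>\<omega>. P \<omega> * Q \<omega>) - (s * expectation P) * (s * expectation Q) \<le> 0"
    using int unfolding covariance_exists_def covariance_def eq by simp
  also have "(s * expectation P) * (s * expectation Q) = expectation P * expectation Q"
    by (simp add: s_def)
  finally have "expectation (\<lambda>\<omega>. P \<omega> * Q \<omega>) \<le> expectation P * expectation Q" by simp
  also have "\<dots> \<le> (\<Prod>k=1..n. expectation (\<lambda>\<omega>. \<phi> (X k \<omega>))) * expectation Q"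
    using Suc.IH Qb by (intro mult_right_mono) (auto simp: P_def)
  finally show ?case by (simp add: P_def Q_def)
qed (simp add: prob_space)

text \<open>Chernoff's method: each exponential has expectation at most 1 + t m + t^2 v exp(tB), and
  the product inequality replaces independence. The term m is there because clipping may destroy
  centring.\<close>

lemma (in prob_space) neg_associated_clip_tail:
  fixes X :: "nat \<Rightarrow> 'a \<Rightarrow> real"
  assumes na: "neg_associated M X {1..}"
    and meas: "\<And>k. k \<ge> 1 \<Longrightarrow> X k \<in> borel_measurable M"
    and B: "B > 0" and t: "t \<ge> 0" and k: "k \<le> n"
    and m: "\<And>i. i \<ge> 1 \<Longrightarrow> \<bar>expectation (\<lambda>\<omega>. clip B (X i \<omega>))\<bar> \<le> m"
    and v: "\<And>i. i \<ge> 1 \<Longrightarrow> expectation (\<lambda>\<omega>. (clip B (X i \<omega>))\<^sup>2) \<le> v"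
  shows "prob {\<omega> \<in> space M. \<bar>\<Sum>i=1..k. clip B (X i \<omega>)\<bar> \<ge> x}
    \<le> 2 * exp (- t * x + real n * (t * m + t\<^sup>2 * v * exp (t * B)))"
proof -
  define w where "w = t * m + t\<^sup>2 * v * exp (t * B)"
  have [measurable]: "(\<lambda>\<omega>. clip B (X i \<omega>)) \<in> borel_measurable M" if "i \<ge> 1" for i
    using measurable_compose[OF meas[OF that] measurable_clip] .
  have "m \<ge> 0" using m[of 1] by simp
  have "v \<ge> 0" by (rule order_trans[OF _ v[of 1]]) auto
  have w: "w \<ge> 0" using t \<open>m \<ge> 0\<close> \<open>v \<ge> 0\<close> by (simp add: w_def)
  have one: "prob {\<omega> \<in> space M. s * (\<Sum>i=1..k. clip B (X i \<omega>)) \<ge> x} \<le> exp (- t * x + real n * w)"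
    if s: "s = 1 \<or> s = -1" for s :: real
  proof -
    define \<phi> where "\<phi> = (\<lambda>y. exp (s * t * clip B y))"
    have mono: "mono \<phi> \<or> antimono \<phi>"
      using s
    proof
      assume "s = 1"
      then have "mono \<phi>"
        using t by (auto simp: \<phi>_def intro!: monoI mult_left_mono clip_mono)
      then show ?thesis ..
    next
      assume "s = -1"
      then have "antimono \<phi>"
        using t by (intro antimonoI) (simp add: \<phi>_def mult_left_mono clip_mono)
      then show ?thesis ..
    qed
    have u: "\<bar>s * t * clip B y\<bar> \<le> t * B" for y
      using s t B abs_clip_le[of B y] by (auto simp: abs_mult intro!: mult_left_mono)
    have \<phi>le: "\<phi> y \<le> exp (t * B)" for y
      using u[of y] by (simp add: \<phi>_def)
    have \<phi>pos: "0 \<le> \<phi> y" for y by (simp add: \<phi>_def)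
    have \<phi>meas [measurable]: "\<phi> \<in> borel_measurable borel" unfolding \<phi>_def by measurable
    have [measurable]: "(\<lambda>\<omega>. \<phi> (X i \<omega>)) \<in> borel_measurable M" if "i \<ge> 1" for i
      using measurable_compose[OF meas[OF that] \<phi>meas] .
    have E1: "expectation (\<lambda>\<omega>. \<phi> (X i \<omega>)) \<le> exp w" if i: "i \<ge> 1" for i
    proof -
      let ?c = "\<lambda>\<omega>. clip B (X i \<omega>)"
      have ic: "integrable M ?c" "integrable M (\<lambda>\<omega>. (?c \<omega>)\<^sup>2)" "integrable M (\<lambda>\<omega>. \<phi> (X i \<omega>))"
      proof -
        show "integrable M ?c"
          using B i by (intro integrable_const_bound[where B = B]) (auto intro!: AE_I2 abs_clip_le)
        show "integrable M (\<lambda>\<omega>. (?c \<omega>)\<^sup>2)"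
          using B i by (intro integrable_const_bound[where B = "B\<^sup>2"])
            (auto intro!: AE_I2 abs_clip_le simp: abs_le_square_iff[symmetric])
        show "integrable M (\<lambda>\<omega>. \<phi> (X i \<omega>))"
          using i \<phi>pos \<phi>le by (intro integrable_const_bound[where B = "exp (t * B)"]) auto
      qed
      have "expectation (\<lambda>\<omega>. \<phi> (X i \<omega>))
        \<le> expectation (\<lambda>\<omega>. 1 + s * t * ?c \<omega> + t\<^sup>2 * exp (t * B) * (?c \<omega>)\<^sup>2)"
      proof (rule integral_mono)
        fix \<omega>
        have "\<phi> (X i \<omega>) \<le> 1 + s * t * ?c \<omega> + (s * t * ?c \<omega>)\<^sup>2 * exp \<bar>s * t * ?c \<omega>\<bar>"
          unfolding \<phi>_def by (rule exp_le_quadratic_exp)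
        also have "\<dots> \<le> 1 + s * t * ?c \<omega> + (s * t * ?c \<omega>)\<^sup>2 * exp (t * B)"
          using u[of "X i \<omega>"] by (intro add_left_mono mult_left_mono) auto
        also have "(s * t * ?c \<omega>)\<^sup>2 = t\<^sup>2 * (?c \<omega>)\<^sup>2"
          using s by (auto simp: power_mult_distrib)
        finally show "\<phi> (X i \<omega>) \<le> 1 + s * t * ?c \<omega> + t\<^sup>2 * exp (t * B) * (?c \<omega>)\<^sup>2"
          by (simp add: algebra_simps)
      qed (use ic in auto)
      also have "\<dots> = 1 + s * t * expectation ?c + t\<^sup>2 * exp (t * B) * expectation (\<lambda>\<omega>. (?c \<omega>)\<^sup>2)"
        using ic by (simp add: prob_space)
      also have "\<dots> \<le> 1 + t * m + t\<^sup>2 * exp (t * B) * v"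
      proof (intro add_mono order_refl mult_left_mono v i)
        have "s * t * expectation ?c \<le> \<bar>s * t * expectation ?c\<bar>" by (rule abs_ge_self)
        also have "\<dots> = t * \<bar>expectation ?c\<bar>" using s t by (auto simp: abs_mult)
        also have "\<dots> \<le> t * m" using t m[OF i] by (intro mult_left_mono)
        finally show "s * t * expectation ?c \<le> t * m" .
      qed auto
      also have "\<dots> = 1 + w" by (simp add: w_def)
      also have "\<dots> \<le> exp w" by (rule exp_ge_add_one_self)
      finally show ?thesis .
    qed
    have prod: "(\<Prod>i=1..k. \<phi> (X i \<omega>)) = exp (s * t * (\<Sum>i=1..k. clip B (X i \<omega>)))" for \<omega>
      by (simp add: \<phi>_def exp_sum sum_distrib_left)
    have int: "integrable M (\<lambda>\<omega>. \<Prod>i=1..k. \<phi> (X i \<omega>))"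
    proof (rule integrable_const_bound[where B = "exp (t * B) ^ k"])
      show "AE \<omega> in M. norm (\<Prod>i=1..k. \<phi> (X i \<omega>)) \<le> exp (t * B) ^ k"
      proof (rule AE_I2)
        fix \<omega>
        show "norm (\<Prod>i=1..k. \<phi> (X i \<omega>)) \<le> exp (t * B) ^ k"
          using \<phi>pos \<phi>le prod_mono[of "{1..k}" "\<lambda>i. \<phi> (X i \<omega>)" "\<lambda>_. exp (t * B)"]
          by (simp add: prod_nonneg abs_of_nonneg)
      qed
    qed (auto intro!: borel_measurable_prod)
    have "prob {\<omega> \<in> space M. s * (\<Sum>i=1..k. clip B (X i \<omega>)) \<ge> x}
      \<le> prob {\<omega> \<in> space M. (\<Prod>i=1..k. \<phi> (X i \<omega>)) \<ge> exp (t * x)}"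
    proof (rule finite_measure_mono)
      show "{\<omega> \<in> space M. s * (\<Sum>i=1..k. clip B (X i \<omega>)) \<ge> x}
        \<subseteq> {\<omega> \<in> space M. (\<Prod>i=1..k. \<phi> (X i \<omega>)) \<ge> exp (t * x)}"
        unfolding prod using t by (auto simp: mult.assoc mult.left_commute[of s] intro!: mult_left_mono)
    qed (use int in measurable)
    also have "\<dots> \<le> expectation (\<lambda>\<omega>. \<Prod>i=1..k. \<phi> (X i \<omega>)) / exp (t * x)"
      by (rule integral_Markov_inequality_measure[OF int, where A = "{}"])
        (auto intro!: prod_nonneg \<phi>pos)
    also have "\<dots> \<le> (\<Prod>i=1..k. expectation (\<lambda>\<omega>. \<phi> (X i \<omega>))) / exp (t * x)"
      using neg_associated_expectation_prod_le[OF na meas mono \<phi>pos \<phi>le \<phi>meas, of k]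
      by (intro divide_right_mono) auto
    also have "\<dots> \<le> (\<Prod>i=1..k. exp w) / exp (t * x)"
      using E1 \<phi>pos by (intro divide_right_mono prod_mono) auto
    also have "\<dots> = exp (- t * x + real k * w)"
      using exp_diff[of "real k * w" "t * x"] by (simp add: exp_of_nat_mult)
    \<comment> \<open>As w >= 0, k may be replaced by n, which makes the bound uniform for the later
      union over k.\<close>
    also have "\<dots> \<le> exp (- t * x + real n * w)"
      using k w by (simp add: mult_right_mono)
    finally show ?thesis .
  qed
  have [measurable]: "(\<lambda>\<omega>. \<Sum>i=1..k. clip B (X i \<omega>)) \<in> borel_measurable M"
    by (intro borel_measurable_sum) auto
  let ?A = "\<lambda>s. {\<omega> \<in> space M. s * (\<Sum>i=1..k. clip B (X i \<omega>)) \<ge> x}"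
  have "prob {\<omega> \<in> space M. \<bar>\<Sum>i=1..k. clip B (X i \<omega>)\<bar> \<ge> x} \<le> prob (?A 1 \<union> ?A (-1))"
  proof (rule finite_measure_mono)
    show "{\<omega> \<in> space M. \<bar>\<Sum>i=1..k. clip B (X i \<omega>)\<bar> \<ge> x} \<subseteq> ?A 1 \<union> ?A (-1)"
      by (auto simp: abs_if split: if_splits)
  qed measurable
  also have "\<dots> \<le> prob (?A 1) + prob (?A (-1))"
    by (rule measure_Un_le) measurable
  also have "\<dots> \<le> 2 * exp (- t * x + real n * w)"
    using one[of 1] one[of "-1"] by simp
  finally show ?thesis unfolding w_def .
qed

text \<open>Unless some |X_i| exceeds B, clipping has no effect; that exception costs the first
  term, by Markov's inequality. The clipped sums are handled by a union over k, affordable because a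
  suitable t gives any polynomial decay.\<close>

lemma (in prob_space) tail_bound_neg_associated:
  fixes X :: "nat \<Rightarrow> 'a \<Rightarrow> real"
  assumes na: "neg_associated M X {1..}"
    and cent: "\<And>k. k \<ge> 1 \<Longrightarrow> centered M (X k)"
    and p: "p \<ge> 2" and B: "B > 0" and t: "t \<ge> 0" and n: "n \<ge> 1"
    and int: "\<And>k. k \<ge> 1 \<Longrightarrow> integrable M (\<lambda>\<omega>. if B < \<bar>X k \<omega>\<bar> then \<bar>X k \<omega>\<bar> powr p else 0)"
    and le: "\<And>k. k \<ge> 1 \<Longrightarrow> (\<integral>\<omega>. (if B < \<bar>X k \<omega>\<bar> then \<bar>X k \<omega>\<bar> powr p else 0) \<partial>M) \<le> \<tau>"
    and intp: "\<And>k. k \<ge> 1 \<Longrightarrow> integrable M (\<lambda>\<omega>. \<bar>X k \<omega>\<bar> powr p)"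
    and lep: "\<And>k. k \<ge> 1 \<Longrightarrow> (\<integral>\<omega>. \<bar>X k \<omega>\<bar> powr p \<partial>M) \<le> \<kappa>"
  shows "prob {\<omega> \<in> space M. max_partial_sum X n \<omega> > x}
    \<le> real n * (B powr (- p) * \<tau>)
      + real n * (2 * exp (- t * x + real n * (t * (B powr (1 - p) * \<tau>) + t\<^sup>2 * (1 + \<kappa>) * exp (t * B))))"
proof -
  let ?V = "\<lambda>k \<omega>. if B < \<bar>X k \<omega>\<bar> then \<bar>X k \<omega>\<bar> powr p else 0"
  have iX: "integrable M (X k)" and eX: "expectation (X k) = 0" if "k \<ge> 1" for k
    using cent[OF that] by (auto simp: centered_def)
  have meas [measurable]: "X k \<in> borel_measurable M" if "k \<ge> 1" for k
    using iX[OF that] by simp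
  have mc [measurable]: "(\<lambda>\<omega>. clip B (X i \<omega>)) \<in> borel_measurable M" if "i \<ge> 1" for i
    using measurable_compose[OF meas[OF that] measurable_clip] .
  have m: "\<bar>expectation (\<lambda>\<omega>. clip B (X k \<omega>))\<bar> \<le> B powr (1 - p) * \<tau>" if k: "k \<ge> 1" for k
  proof -
    have ic: "integrable M (\<lambda>\<omega>. clip B (X k \<omega>))"
      using B k by (intro integrable_const_bound[where B = B]) (auto intro!: AE_I2 abs_clip_le)
    \<comment> \<open>By centring, the mean equals that of the clipping error, which vanishes unless
      |X_k| > B; there |X_k| <= B^(1-p) |X_k|^p.\<close>
    have "expectation (\<lambda>\<omega>. clip B (X k \<omega>)) = expectation (\<lambda>\<omega>. clip B (X k \<omega>) - X k \<omega>)"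
      using ic iX[OF k] eX[OF k] by simp
    also have "\<bar>\<dots>\<bar> \<le> expectation (\<lambda>\<omega>. \<bar>clip B (X k \<omega>) - X k \<omega>\<bar>)"
      by (rule integral_abs_bound)
    also have "\<dots> \<le> expectation (\<lambda>\<omega>. B powr (1 - p) * ?V k \<omega>)"
    proof (rule integral_mono)
      fix \<omega>
      show "\<bar>clip B (X k \<omega>) - X k \<omega>\<bar> \<le> B powr (1 - p) * ?V k \<omega>"
      proof (cases "B < \<bar>X k \<omega>\<bar>")
        case True
        have "\<bar>clip B (X k \<omega>) - X k \<omega>\<bar> \<le> \<bar>X k \<omega>\<bar>"
          using B by (auto simp: clip_def)
        also have "\<dots> = \<bar>X k \<omega>\<bar> powr (1 - p) * \<bar>X k \<omega>\<bar> powr p"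
          using True B by (simp add: powr_add[symmetric])
        also have "\<dots> \<le> B powr (1 - p) * \<bar>X k \<omega>\<bar> powr p"
          using True B p by (intro mult_right_mono powr_mono2') auto
        finally show ?thesis using True by simp
      qed (simp add: clip_eq)
    qed (use ic iX[OF k] int[OF k] in auto)
    also have "\<dots> \<le> B powr (1 - p) * \<tau>"
      using int[OF k] le[OF k] by (simp add: mult_left_mono)
    finally show ?thesis .
  qed
  have v: "expectation (\<lambda>\<omega>. (clip B (X k \<omega>))\<^sup>2) \<le> 1 + \<kappa>" if k: "k \<ge> 1" for k
  proof -
    have "expectation (\<lambda>\<omega>. (clip B (X k \<omega>))\<^sup>2) \<le> expectation (\<lambda>\<omega>. 1 + \<bar>X k \<omega>\<bar> powr p)"
    proof (rule integral_mono)
      show "integrable M (\<lambda>\<omega>. (clip B (X k \<omega>))\<^sup>2)"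
        using B k by (intro integrable_const_bound[where B = "B\<^sup>2"])
          (auto intro!: AE_I2 abs_clip_le simp: abs_le_square_iff[symmetric])
      fix \<omega>
      have "(clip B (X k \<omega>))\<^sup>2 \<le> (X k \<omega>)\<^sup>2"
        using B abs_clip_le_abs[of B "X k \<omega>"] by (simp add: abs_le_square_iff[symmetric])
      also have "\<dots> \<le> 1 + \<bar>X k \<omega>\<bar> powr p"
      proof (cases "\<bar>X k \<omega>\<bar> \<le> 1")
        case True
        then have "(X k \<omega>)\<^sup>2 \<le> 1" by (simp add: abs_square_le_1)
        then show ?thesis by (simp add: add_increasing2)
      next
        case False
        then have "\<bar>X k \<omega>\<bar> powr 2 \<le> \<bar>X k \<omega>\<bar> powr p" using p by (intro powr_mono) auto
        then show ?thesis using False by (simp add: powr_numeral)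
      qed
      finally show "(clip B (X k \<omega>))\<^sup>2 \<le> 1 + \<bar>X k \<omega>\<bar> powr p" .
    qed (use intp[OF k] in auto)
    also have "\<dots> \<le> 1 + \<kappa>" using intp[OF k] lep[OF k] by (simp add: prob_space)
    finally show ?thesis .
  qed
  define EA where "EA = (\<lambda>k. {\<omega> \<in> space M. B < \<bar>X k \<omega>\<bar>})"
  define EC where "EC = (\<lambda>k. {\<omega> \<in> space M. \<bar>\<Sum>i=1..k. clip B (X i \<omega>)\<bar> \<ge> x})"
  have mA: "EA k \<in> events" if "k \<ge> 1" for k using that unfolding EA_def by measurable
  have mC: "EC k \<in> events" for k
  proof -
    have [measurable]: "(\<lambda>\<omega>. \<Sum>i=1..k. clip B (X i \<omega>)) \<in> borel_measurable M"
      by (intro borel_measurable_sum) auto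
    show ?thesis unfolding EC_def by measurable
  qed
  have PA: "prob (EA k) \<le> B powr (- p) * \<tau>" if k: "k \<ge> 1" for k
  proof -
    have "prob (EA k) \<le> prob {\<omega> \<in> space M. ?V k \<omega> \<ge> B powr p}"
    proof (rule finite_measure_mono)
      show "EA k \<subseteq> {\<omega> \<in> space M. ?V k \<omega> \<ge> B powr p}"
        using B p by (auto simp: EA_def intro!: powr_mono2)
    qed (use int[OF k] in measurable)
    also have "\<dots> \<le> expectation (?V k) / B powr p"
      by (rule integral_Markov_inequality_measure[OF int[OF k], where A = "{}"]) (use B in auto)
    also have "\<dots> \<le> \<tau> / B powr p" using le[OF k] by (intro divide_right_mono) auto
    finally show ?thesis by (simp add: powr_minus_divide)
  qed
  have PC: "prob (EC k) \<le> 2 * exp (- t * x + real n * (t * (B powr (1 - p) * \<tau>) + t\<^sup>2 * (1 + \<kappa>) * exp (t * B)))"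
    if k: "k \<le> n" for k
    unfolding EC_def by (rule neg_associated_clip_tail[OF na meas B t k m v])
  have "prob {\<omega> \<in> space M. max_partial_sum X n \<omega> > x}
    \<le> prob ((\<Union>k\<in>{1..n}. EA k) \<union> (\<Union>k\<in>{1..n}. EC k))"
  proof (rule finite_measure_mono)
    show "{\<omega> \<in> space M. max_partial_sum X n \<omega> > x} \<subseteq> (\<Union>k\<in>{1..n}. EA k) \<union> (\<Union>k\<in>{1..n}. EC k)"
    proof
      fix \<omega> assume "\<omega> \<in> {\<omega> \<in> space M. max_partial_sum X n \<omega> > x}"
      then have \<omega>: "\<omega> \<in> space M" and "max_partial_sum X n \<omega> > x" by simp_all
      then obtain k where k: "k \<in> {1..n}" "\<bar>partial_sum X k \<omega>\<bar> > x"
        unfolding max_partial_sum_gt_iff[OF n] by (elim bexE)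
      show "\<omega> \<in> (\<Union>k\<in>{1..n}. EA k) \<union> (\<Union>k\<in>{1..n}. EC k)"
      proof (cases "\<forall>i\<in>{1..k}. \<bar>X i \<omega>\<bar> \<le> B")
        case True
        then have "partial_sum X k \<omega> = (\<Sum>i=1..k. clip B (X i \<omega>))"
          unfolding partial_sum_def by (intro sum.cong) (auto simp: clip_eq)
        then have "\<omega> \<in> EC k" using k(2) \<omega> by (simp add: EC_def)
        then show ?thesis using k(1) by (intro UnI2 UN_I)
      next
        case False
        then obtain i where i: "i \<in> {1..k}" "B < \<bar>X i \<omega>\<bar>" by (auto simp: not_le)
        have "\<omega> \<in> EA i" using \<omega> i(2) by (simp add: EA_def)
        moreover have "i \<in> {1..n}" using i(1) k(1) by simp
        ultimately show ?thesis by (intro UnI1 UN_I)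
      qed
    qed
  qed (use mA mC in auto)
  also have "\<dots> \<le> prob (\<Union>k\<in>{1..n}. EA k) + prob (\<Union>k\<in>{1..n}. EC k)"
    using mA mC by (intro measure_Un_le) auto
  also have "prob (\<Union>k\<in>{1..n}. EA k) \<le> (\<Sum>k\<in>{1..n}. prob (EA k))"
    using mA by (intro finite_measure_subadditive_finite) auto
  also have "\<dots> \<le> (\<Sum>k\<in>{1..n}. B powr (- p) * \<tau>)" using PA by (intro sum_mono) auto
  also have "prob (\<Union>k\<in>{1..n}. EC k) \<le> (\<Sum>k\<in>{1..n}. prob (EC k))"
    using mC by (intro finite_measure_subadditive_finite) auto
  also have "\<dots> \<le> (\<Sum>k\<in>{1..n}. 2 * exp (- t * x + real n * (t * (B powr (1 - p) * \<tau>) + t\<^sup>2 * (1 + \<kappa>) * exp (t * B))))"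
    using PC by (intro sum_mono) auto
  finally show ?thesis by simp
qed

subsection \<open>Summability under a uniform moment bound\<close>

text \<open>Where |X| > b, monotonicity gives f(|X|) >= f(b). The case b = 0 yields the full p-th
  moment, as the excluded value X = 0 contributes 0.\<close>

lemma (in prob_space) tail_moment_bound:
  assumes [measurable]: "X \<in> borel_measurable M"
    and f: "mono_on {0..} f" "\<And>x. x \<ge> 0 \<Longrightarrow> f x > (0::real)" and b: "b \<ge> 0"
    and K: "(\<integral>\<^sup>+ \<omega>. ennreal (\<bar>X \<omega>\<bar> powr p * f \<bar>X \<omega>\<bar>) \<partial>M) \<le> ennreal K" "K \<ge> 0"
  shows "integrable M (\<lambda>\<omega>. if b < \<bar>X \<omega>\<bar> then \<bar>X \<omega>\<bar> powr p else 0)"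
    and "(\<integral>\<omega>. (if b < \<bar>X \<omega>\<bar> then \<bar>X \<omega>\<bar> powr p else 0) \<partial>M) \<le> K * (1 / f b)"
proof -
  let ?V = "\<lambda>\<omega>. if b < \<bar>X \<omega>\<bar> then \<bar>X \<omega>\<bar> powr p else 0"
  have fb: "f b > 0" using f(2)[OF b] .
  have "(\<integral>\<^sup>+ \<omega>. ennreal (?V \<omega> * f b) \<partial>M) \<le> (\<integral>\<^sup>+ \<omega>. ennreal (\<bar>X \<omega>\<bar> powr p * f \<bar>X \<omega>\<bar>) \<partial>M)"
  proof (rule nn_integral_mono)
    fix \<omega>
    have "?V \<omega> * f b \<le> \<bar>X \<omega>\<bar> powr p * f \<bar>X \<omega>\<bar>"
    proof (cases "b < \<bar>X \<omega>\<bar>")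
      case True
      then have "f b \<le> f \<bar>X \<omega>\<bar>" using b by (intro mono_onD[OF f(1)]) auto
      then show ?thesis using True by (simp add: mult_left_mono)
    next
      case False
      then show ?thesis using f(2)[of "\<bar>X \<omega>\<bar>"] by simp
    qed
    then show "ennreal (?V \<omega> * f b) \<le> ennreal (\<bar>X \<omega>\<bar> powr p * f \<bar>X \<omega>\<bar>)"
      by (rule ennreal_leI)
  qed
  also note K(1)
  finally have *: "(\<integral>\<^sup>+ \<omega>. ennreal (?V \<omega> * f b) \<partial>M) \<le> ennreal K" .
  have int: "integrable M (\<lambda>\<omega>. ?V \<omega> * f b)"
  proof (rule integrableI_nonneg)
    show "(\<integral>\<^sup>+ \<omega>. ennreal (?V \<omega> * f b) \<partial>M) < \<infinity>"
      using * by (rule order_le_less_trans) simp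
    show "AE \<omega> in M. 0 \<le> ?V \<omega> * f b" using fb by auto
  qed measurable
  have "(\<lambda>\<omega>. ?V \<omega> * f b / f b) = ?V" using fb by auto
  then show "integrable M ?V" using integrable_divide[OF int, of "f b"] by metis
  have "(\<integral>\<omega>. ?V \<omega> * f b \<partial>M) \<le> K"
    using * fb K(2) by (subst (asm) nn_integral_eq_integral[OF int]) auto
  then show "(\<integral>\<omega>. ?V \<omega> \<partial>M) \<le> K * (1 / f b)"
    using fb by (simp add: field_simps)
qed

locale uniform_moment_bound = prob_space M for M :: "'a measure" +
  fixes X :: "nat \<Rightarrow> 'a \<Rightarrow> real" and f :: "real \<Rightarrow> real" and p r K :: real
  assumes measurable_X: "\<And>n. n \<ge> 1 \<Longrightarrow> X n \<in> borel_measurable M"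
    and f_pos: "\<And>x. x \<ge> 0 \<Longrightarrow> f x > 0"
    and f_mono: "mono_on {0..} f"
    and f_summable: "summable (\<lambda>n. 1 / f (2 ^ n))"
    and r_pos: "r > 0" and p_pos: "p > 0"
    and K_nonneg: "K \<ge> 0"
    and moment: "\<And>n. n \<ge> 1 \<Longrightarrow> (\<integral>\<^sup>+ \<omega>. ennreal (\<bar>X n \<omega>\<bar> powr p * f \<bar>X n \<omega>\<bar>) \<partial>M) \<le> ennreal K"
begin

lemma tail_moment:
  assumes "n \<ge> 1" "b \<ge> 0"
  shows tail_integrable: "integrable M (\<lambda>\<omega>. if b < \<bar>X n \<omega>\<bar> then \<bar>X n \<omega>\<bar> powr p else 0)"
    and tail_le: "(\<integral>\<omega>. (if b < \<bar>X n \<omega>\<bar> then \<bar>X n \<omega>\<bar> powr p else 0) \<partial>M) \<le> K * (1 / f b)"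
  by (rule tail_moment_bound[OF measurable_X f_mono f_pos _ moment K_nonneg, OF assms(1) _ assms(2,1)];
      assumption)+

lemma inverse_f_antimono: "0 \<le> x \<Longrightarrow> x \<le> y \<Longrightarrow> 1 / f y \<le> 1 / f x"
  using f_pos[of x] mono_onD[OF f_mono, of x y] by (intro divide_left_mono) (auto intro: f_pos)

text \<open>The form in which summability of 1 / f(2^n) enters all three cases, with a truncation
  level that is a constant times a power of n.\<close>

lemma summable_weight:
  assumes "c > 0" "s > 0"
  shows "summable (\<lambda>n. 1 / f (c * real n powr s) / real n)"
  using summable_powr_condensed[where u = "\<lambda>x. 1 / f x", OF inverse_f_antimono _ f_summable assms]
    f_pos by (simp add: less_imp_le)

lemma summable_arbitrary:
  assumes "p \<le> 1" "r < 1" "\<epsilon> > 0"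
  shows "summable (\<lambda>n. real n powr (p / r - 2) *
    prob {\<omega> \<in> space M. max_partial_sum X n \<omega> > \<epsilon> * real n powr (1 / r)})"
proof (rule summable_comparison_test_ev)
  \<comment> \<open>The truncation level c / (2n) becomes (\<epsilon> / 2) n^s, and r < 1 makes s
    positive.\<close>
  define s where "s = 1 / r - 1"
  have "s > 0" using assms r_pos by (simp add: s_def field_simps)
  then have "summable (\<lambda>n. 1 / f (\<epsilon> / 2 * real n powr s) / real n)"
    using assms by (intro summable_weight) auto
  then show "summable (\<lambda>n. (\<epsilon> / 2) powr (- p) * (K * (1 / f (\<epsilon> / 2 * real n powr s) / real n)))"
    by (intro summable_mult)
  show "\<forall>\<^sub>F n in sequentially. norm (real n powr (p / r - 2) *
      prob {\<omega> \<in> space M. max_partial_sum X n \<omega> > \<epsilon> * real n powr (1 / r)})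
      \<le> (\<epsilon> / 2) powr (- p) * (K * (1 / f (\<epsilon> / 2 * real n powr s) / real n))"
    using eventually_ge_at_top[of 1]
  proof eventually_elim
    case (elim n)
    let ?c = "\<epsilon> * real n powr (1 / r)"
    have b: "?c / (2 * real n) = \<epsilon> / 2 * real n powr s"
      using elim by (simp add: s_def powr_diff)
    have "prob {\<omega> \<in> space M. max_partial_sum X n \<omega> > ?c}
      \<le> (?c / 2) powr (- p) * (real n * (K * (1 / f (?c / (2 * real n)))))"
      using elim assms p_pos
      by (intro tail_bound_arbitrary measurable_X tail_integrable tail_le) auto
    then have "real n powr (p / r - 2) * prob {\<omega> \<in> space M. max_partial_sum X n \<omega> > ?c}
      \<le> real n powr (p / r - 2) * ((\<epsilon> / 2 * real n powr (1 / r)) powr (- p)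
          * (real n * (K * (1 / f (\<epsilon> / 2 * real n powr s)))))"
      unfolding b by (intro mult_left_mono) auto
    also have "\<dots> = (\<epsilon> / 2) powr (- p) * (K * (1 / f (\<epsilon> / 2 * real n powr s)) / real n)"
      using elim assms by (intro powr_weight) auto
    finally show ?case by simp
  qed
qed

lemma summable_martingale_difference:
  assumes "martingale_difference M F X" "1 \<le> p" "p \<le> 2" "r < 2" "\<epsilon> > 0"
  shows "summable (\<lambda>n. real n powr (p / r - 2) *
    prob {\<omega> \<in> space M. max_partial_sum X n \<omega> > \<epsilon> * real n powr (1 / r)})"
proof (rule summable_comparison_test_ev)
  interpret X: martingale_difference M F X by fact
  \<comment> \<open>Positive because r < 2. Since 1/r = 2\<eta> + 1/2, cutting at n^\<eta> leaves
    another n^\<eta> in the exponent after division by sqrt n.\<close>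
  define \<eta> where "\<eta> = (1 / r - 1 / 2) / 2"
  have \<eta>: "\<eta> > 0" using assms r_pos by (simp add: \<eta>_def field_simps)
  let ?G1 = "\<lambda>n. real n powr (p / r - 1) * (2 * exp (1 - \<epsilon> / 4 * real n powr \<eta>))"
  let ?G2 = "\<lambda>n. 4 * (\<epsilon> / 2) powr (- p) * (2 powr (p + 1) * (K * (1 / f (1 * real n powr \<eta>) / real n)))"
  have "summable ?G1" using assms \<eta> by (intro summable_powr_exp) auto
  moreover have "summable ?G2" using \<eta> by (intro summable_mult summable_weight) auto
  ultimately show "summable (\<lambda>n. ?G1 n + ?G2 n)" by (rule summable_add)
  show "\<forall>\<^sub>F n in sequentially. norm (real n powr (p / r - 2) *
      prob {\<omega> \<in> space M. max_partial_sum X n \<omega> > \<epsilon> * real n powr (1 / r)}) \<le> ?G1 n + ?G2 n"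
    using eventually_ge_at_top[of 1]
  proof eventually_elim
    case (elim n)
    let ?c = "\<epsilon> * real n powr (1 / r)" and ?b = "real n powr \<eta>"
    have n: "real n > 0" using elim by simp
    have "prob {\<omega> \<in> space M. max_partial_sum X n \<omega> > ?c}
      \<le> real n * (2 * exp (1 - ?c / (4 * ?b * sqrt n)))
        + 4 * (?c / 2) powr (- p) * (real n * (2 powr (p + 1) * (K * (1 / f ?b))))"
      using elim assms by (intro X.tail_bound tail_integrable tail_le) auto
    also have "?c / (4 * ?b * sqrt n) = \<epsilon> / 4 * real n powr \<eta>"
    proof -
      have "real n powr (1 / r) = real n powr \<eta> * (real n powr \<eta> * real n powr (1 / 2))"
        unfolding powr_add[symmetric] by (simp add: \<eta>_def)
      then show ?thesis using n by (simp add: powr_half_sqrt)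
    qed
    finally have "real n powr (p / r - 2) * prob {\<omega> \<in> space M. max_partial_sum X n \<omega> > ?c}
      \<le> real n powr (p / r - 2) * (real n * (2 * exp (1 - \<epsilon> / 4 * real n powr \<eta>))
        + 4 * (?c / 2) powr (- p) * (real n * (2 powr (p + 1) * (K * (1 / f ?b)))))"
      by (intro mult_left_mono) auto
    also have "\<dots> = real n powr (p / r - 2) * real n * (2 * exp (1 - \<epsilon> / 4 * real n powr \<eta>))
        + 4 * (real n powr (p / r - 2) * ((\<epsilon> / 2 * real n powr (1 / r)) powr (- p)
          * (real n * (2 powr (p + 1) * (K * (1 / f ?b))))))"
      by (simp add: algebra_simps)
    also have "real n powr (p / r - 2) * real n = real n powr (p / r - 1)"
      using n powr_add[of "real n" "p / r - 2" 1] by simp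
    also have "real n powr (p / r - 2) * ((\<epsilon> / 2 * real n powr (1 / r)) powr (- p)
          * (real n * (2 powr (p + 1) * (K * (1 / f ?b)))))
        = (\<epsilon> / 2) powr (- p) * (2 powr (p + 1) * (K * (1 / f ?b)) / real n)"
      using n assms by (intro powr_weight) auto
    finally show ?case by (simp add: mult.assoc)
  qed
qed

lemma summable_neg_associated:
  assumes na: "neg_associated M X {1..}" and cent: "\<And>n. n \<ge> 1 \<Longrightarrow> centered M (X n)"
    and p: "p \<ge> 2" and r: "r < 2" and \<epsilon>: "\<epsilon> > 0"
  shows "summable (\<lambda>n. real n powr (p / r - 2) *
    prob {\<omega> \<in> space M. max_partial_sum X n \<omega> > \<epsilon> * real n powr (1 / r)})"
proof (rule summable_comparison_test_ev)
  \<comment> \<open>Chosen so that n^(-L), times the weight and the factor n of the union bound, is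
    n^(-2).\<close>
  define L where "L = p / r + 1"
  \<comment> \<open>Positive because r < 2. As 2/r = 1 + 2\<rho>, having exp(tB) = n^\<rho> gives n
    exp(tB) / n^(2/r) = n^(-\<rho>).\<close>
  define \<rho> where "\<rho> = (2 / r - 1) / 2"
  \<comment> \<open>Clipping at this multiple of n^(1/r) makes tB = \<rho> ln n for the t used
    below.\<close>
  define \<theta> where "\<theta> = \<epsilon> * \<rho> / L"
  \<comment> \<open>The tail bound at 0, hence a bound on the full p-th moments.\<close>
  define \<kappa> where "\<kappa> = K * (1 / f 0)"
  have L: "L > 0" using p r_pos by (simp add: L_def add_pos_pos)
  have \<rho>: "\<rho> > 0" using r r_pos by (simp add: \<rho>_def field_simps)
  have \<theta>: "\<theta> > 0" using L \<rho> \<epsilon> by (simp add: \<theta>_def)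
  have \<kappa>: "\<kappa> \<ge> 0" using K_nonneg f_pos[of 0] by (simp add: \<kappa>_def)
  have abs_p: "(if 0 < \<bar>x\<bar> then \<bar>x\<bar> powr p else 0) = \<bar>x\<bar> powr p" for x :: real
    using p by simp
  let ?G1 = "\<lambda>n. \<theta> powr (- p) * (K * (1 / f (\<theta> * real n powr (1 / r)) / real n))"
  let ?G2 = "\<lambda>n. 2 * exp 1 * real n powr (- 2)"
  have "summable ?G1" using \<theta> r_pos by (intro summable_mult summable_weight) auto
  moreover have "summable ?G2" by (intro summable_mult) (simp add: summable_real_powr_iff)
  ultimately show "summable (\<lambda>n. ?G1 n + ?G2 n)" by (rule summable_add)
  \<comment> \<open>Holds as p >= 2 > r. This is the power of n in the error caused by the means of
    the clipped variables.\<close>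
  have "1 - p / r < 0" using p r r_pos by (simp add: field_simps)
  then have ev: "eventually (\<lambda>n::nat. (L / \<epsilon> * \<theta> powr (1 - p) * \<kappa>) * real n powr (1 - p / r) * ln (real n)
      + ((L / \<epsilon>)\<^sup>2 * (1 + \<kappa>)) * real n powr (- \<rho>) * (ln (real n))\<^sup>2 \<le> 1) at_top"
    using \<rho> by (intro bounded_powr_ln) auto
  show "\<forall>\<^sub>F n in sequentially. norm (real n powr (p / r - 2) *
      prob {\<omega> \<in> space M. max_partial_sum X n \<omega> > \<epsilon> * real n powr (1 / r)}) \<le> ?G1 n + ?G2 n"
    using ev eventually_ge_at_top[of 1]
  proof eventually_elim
    case (elim n)
    define a where "a = real n powr (1 / r)"
    define B where "B = \<theta> * a"
    \<comment> \<open>With this choice t times the level \<epsilon> a equals L ln n, which produces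
      the decay n^(-L).\<close>
    define t where "t = L / (\<epsilon> * a) * ln (real n)"
    define \<tau> where "\<tau> = K * (1 / f B)"
    have n: "real n > 0" using elim(2) by simp
    have a: "a > 0" using n by (simp add: a_def)
    have B: "B > 0" using a \<theta> by (simp add: B_def)
    have t: "t \<ge> 0" using L \<epsilon> a elim(2) by (simp add: t_def)
    \<comment> \<open>Inside the exponent the crude constant \<kappa> is enough; the decay of \<tau>
      matters for the term coming from values above B.\<close>
    have \<tau>: "\<tau> \<le> \<kappa>"
      unfolding \<tau>_def \<kappa>_def using B K_nonneg by (intro mult_left_mono inverse_f_antimono) auto
    let ?e = "real n * (t * (B powr (1 - p) * \<tau>) + t\<^sup>2 * (1 + \<kappa>) * exp (t * B))"
    have "?e \<le> real n * (t * (B powr (1 - p) * \<kappa>) + t\<^sup>2 * (1 + \<kappa>) * exp (t * B))"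
      using t \<tau> by (intro mult_left_mono add_right_mono) auto
    also have "\<dots> = (L / \<epsilon> * \<theta> powr (1 - p) * \<kappa>) * real n powr (1 - p / r) * ln (real n)
      + ((L / \<epsilon>)\<^sup>2 * (1 + \<kappa>)) * real n powr (- \<rho>) * (ln (real n))\<^sup>2"
    proof -
      have "B powr (1 - p) = \<theta> powr (1 - p) * (a * a powr (- p))"
        using \<theta> a by (simp add: B_def powr_mult powr_diff powr_minus field_simps)
      moreover have "a powr (- p) * real n = real n powr (1 - p / r)"
        using n powr_add[of "real n" "- p / r" 1] by (simp add: a_def powr_powr)
      ultimately have 1: "real n * (t * (B powr (1 - p) * \<kappa>))
          = (L / \<epsilon> * \<theta> powr (1 - p) * \<kappa>) * real n powr (1 - p / r) * ln (real n)"
        using a \<epsilon> by (simp add: t_def field_simps)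
      have "t * B = \<rho> * ln (real n)"
        using a \<epsilon> L by (simp add: t_def B_def \<theta>_def)
      then have 2: "exp (t * B) = real n powr \<rho>" using n by (simp add: powr_def)
      have "a\<^sup>2 = real n powr (2 / r)"
        using n by (simp add: a_def powr_power)
      also have "2 / r = 1 + \<rho> + \<rho>" by (simp add: \<rho>_def field_simps)
      finally have "a\<^sup>2 = real n * real n powr \<rho> * real n powr \<rho>"
        unfolding powr_add using n by simp
      then have 3: "real n * real n powr \<rho> / a\<^sup>2 = real n powr (- \<rho>)"
        using n by (simp add: powr_minus field_simps)
      have "t\<^sup>2 = (L / \<epsilon>)\<^sup>2 * (ln (real n))\<^sup>2 / a\<^sup>2"
        by (simp add: t_def power_mult_distrib power_divide)
      then have "real n * (t\<^sup>2 * (1 + \<kappa>) * exp (t * B))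
          = ((L / \<epsilon>)\<^sup>2 * (1 + \<kappa>)) * (real n * real n powr \<rho> / a\<^sup>2) * (ln (real n))\<^sup>2"
        unfolding 2 by simp
      then show ?thesis unfolding 3 distrib_left 1 by simp
    qed
    also have "\<dots> \<le> 1" by (rule elim(1))
    finally have e: "?e \<le> 1" .
    have tx: "t * (\<epsilon> * a) = L * ln (real n)" using a \<epsilon> by (simp add: t_def)
    have "exp (- t * (\<epsilon> * a) + ?e) \<le> exp (1 - L * ln (real n))"
      using e tx by simp
    also have "\<dots> = exp 1 * real n powr (- L)"
      using n by (simp add: powr_def exp_diff exp_minus field_simps)
    finally have E: "exp (- t * (\<epsilon> * a) + ?e) \<le> exp 1 * real n powr (- L)" .
    have "prob {\<omega> \<in> space M. max_partial_sum X n \<omega> > \<epsilon> * a}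
      \<le> real n * (B powr (- p) * \<tau>) + real n * (2 * exp (- t * (\<epsilon> * a) + ?e))"
    proof (rule tail_bound_neg_associated[OF na cent p B t elim(2)])
      fix k :: nat assume k: "k \<ge> 1"
      show "integrable M (\<lambda>\<omega>. if B < \<bar>X k \<omega>\<bar> then \<bar>X k \<omega>\<bar> powr p else 0)"
        "(\<integral>\<omega>. (if B < \<bar>X k \<omega>\<bar> then \<bar>X k \<omega>\<bar> powr p else 0) \<partial>M) \<le> \<tau>"
        unfolding \<tau>_def by (rule tail_moment[OF k less_imp_le[OF B]])+
      show "integrable M (\<lambda>\<omega>. \<bar>X k \<omega>\<bar> powr p)" "(\<integral>\<omega>. \<bar>X k \<omega>\<bar> powr p \<partial>M) \<le> \<kappa>"
        using tail_integrable[OF k order_refl] tail_le[OF k order_refl]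
        unfolding abs_p \<kappa>_def by auto
    qed
    also have "\<dots> \<le> (\<theta> * real n powr (1 / r)) powr (- p) * (real n * \<tau>)
        + real n * (2 * (exp 1 * real n powr (- L)))"
      using E unfolding B_def a_def[symmetric]
      by (intro add_mono mult_left_mono) (auto simp: mult_ac)
    finally have "real n powr (p / r - 2) * prob {\<omega> \<in> space M. max_partial_sum X n \<omega> > \<epsilon> * a}
      \<le> real n powr (p / r - 2) * ((\<theta> * real n powr (1 / r)) powr (- p) * (real n * \<tau>)
        + real n * (2 * (exp 1 * real n powr (- L))))"
      by (intro mult_left_mono) auto
    also have "\<dots> = real n powr (p / r - 2) * ((\<theta> * real n powr (1 / r)) powr (- p) * (real n * \<tau>))
        + 2 * exp 1 * (real n powr (p / r - 2) * (real n powr 1 * real n powr (- L)))"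
      using n by (simp add: algebra_simps)
    also have "real n powr (p / r - 2) * ((\<theta> * real n powr (1 / r)) powr (- p) * (real n * \<tau>))
        = \<theta> powr (- p) * (\<tau> / real n)"
      using n \<theta> by (rule powr_weight)
    also have "real n powr (p / r - 2) * (real n powr 1 * real n powr (- L)) = real n powr (- 2)"
      unfolding powr_add[symmetric] by (simp add: L_def)
    finally show ?case by (simp add: \<tau>_def B_def a_def)
  qed
qed

end

section \<open>Reduction of the theorem to the three summability results\<close>

theorem theorem1p15:
  fixes M :: "'a measure" and X :: "nat \<Rightarrow> 'a \<Rightarrow> real"
    and f :: "real \<Rightarrow> real" and r p :: real
  assumes "prob_space M"
    and "\<And>n. n \<ge> 1 \<Longrightarrow> X n \<in> borel_measurable M"
    and "\<And>x. x \<ge> 0 \<Longrightarrow> f x > 0"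
    and "mono_on {0..} f"
    and "(\<lambda>n::nat. 1 / f (2 ^ n)) summable_on {1..}"
    and "0 < r" and "r < 2" and "r \<le> p"
    and "(p \<le> 1 \<and> r < 1)
       \<or> ((1 < p \<and> p \<le> 2 \<or> r = 1 \<and> p = 1) \<and> martingale_difference_seq M X)
       \<or> (p \<ge> 2 \<and> (\<forall>n\<ge>1. centered M (X n)) \<and> neg_associated M X {1..})"
    and "(SUP n\<in>{1..}. \<integral>\<^sup>+ \<omega>. ennreal (\<bar>X n \<omega>\<bar> powr p * f \<bar>X n \<omega>\<bar>) \<partial>M) < \<infinity>"
  shows "\<forall>\<epsilon>>0. (\<lambda>n::nat. real n powr (p / r - 2) *
            measure M {\<omega> \<in> space M. max_partial_sum X n \<omega> > \<epsilon> * real n powr (1 / r)})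
          summable_on {1..}"
proof (intro allI impI)
  fix \<epsilon> :: real assume \<epsilon>: "\<epsilon> > 0"
  let ?I = "\<lambda>n. \<integral>\<^sup>+ \<omega>. ennreal (\<bar>X n \<omega>\<bar> powr p * f \<bar>X n \<omega>\<bar>) \<partial>M"
  \<comment> \<open>The supremum is finite, so passing to a real number by \<open>enn2real\<close>
    loses nothing.\<close>
  define K where "K = enn2real (SUP n\<in>{1..}. ?I n)"
  have "summable (\<lambda>n. 1 / f (2 ^ n))"
    using assms(3,5) by (subst (asm) nonneg_summable_on_atLeast_iff) (auto simp: less_imp_le)
  moreover have "?I n \<le> ennreal K" if "n \<ge> 1" for n
    unfolding K_def using assms(10) that by (subst ennreal_enn2real) (auto intro!: SUP_upper)
  ultimately interpret uniform_moment_bound M X f p r K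
    using assms by (intro uniform_moment_bound.intro uniform_moment_bound_axioms.intro)
      (auto simp: K_def)
  \<comment> \<open>The case r = p = 1 joins 1 < p <= 2, as the martingale argument covers all p in
    [1, 2].\<close>
  consider (arbitrary) "p \<le> 1" "r < 1"
    | (martingale) "1 \<le> p" "p \<le> 2" "martingale_difference_seq M X"
    | (neg_associated) "p \<ge> 2" "\<forall>n\<ge>1. centered M (X n)" "neg_associated M X {1..}"
    using assms(9) by force
  then have "summable (\<lambda>n. real n powr (p / r - 2) *
      prob {\<omega> \<in> space M. max_partial_sum X n \<omega> > \<epsilon> * real n powr (1 / r)})"
  proof cases
    case arbitrary
    then show ?thesis using \<epsilon> by (rule summable_arbitrary)
  next
    case martingale
    then obtain F where "filtration (space M) F" "\<forall>n. subalgebra M (F n)"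
      "\<forall>n\<ge>1. integrable M (X n) \<and> X n \<in> borel_measurable (F n) \<and>
        (AE \<omega> in M. real_cond_exp M (F (n - 1)) (X n) \<omega> = 0)"
      unfolding martingale_difference_seq_def by (elim exE conjE)
    then have "martingale_difference M F X"
      by (intro martingale_difference.intro martingale_difference_axioms.intro assms(1)) auto
    then show ?thesis using martingale(1,2) assms(7) \<epsilon> by (rule summable_martingale_difference)
  next
    case neg_associated
    then show ?thesis using assms(7) \<epsilon> by (intro summable_neg_associated) auto
  qed
  then show "(\<lambda>n::nat. real n powr (p / r - 2) *
      measure M {\<omega> \<in> space M. max_partial_sum X n \<omega> > \<epsilon> * real n powr (1 / r)}) summable_on {1..}"
    by (subst nonneg_summable_on_atLeast_iff) auto
qed

end
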